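(* Let $L(n)$ be an integer-valued function of the positive integer $n$ such that $1\le L(n)\le n$ for all $n$ and $L(n)\to\infty$ as $n\to\infty$. Then there are cyclic permutations $\sigma_n$ of $[n]=\{0,1,\ldots,n-1\}$ such that $$\mu(\sigma_n)=n+\Theta(nL(n)),$$ i.e. there are constants $c,C>0$ such that $c\,nL(n)\le \mu(\sigma_n)-n\le C\,nL(n)$ for all sufficiently large $n$, where $\mu$ denotes the meander number.
   Context: A cyclic permutation $\sigma$ of $[n]=\{0,1,\ldots,n-1\}$ is a permutation consisting of a single $n$-cycle; it is written in cycle notation $\sigma=(\sigma_0,\sigma_1,\ldots,\sigma_{n-1})$, a listing of all elements of $[n]$ understood up to cyclic rotation. Meander number. A set of pairs of elements of $[N]$ is non-crossing if it does not contain two pairs $\{a_1,b_1\},\{a_2,b_2\}$ with $a_1<a_2<b_1<b_2$. For $N$ even and positive, a cyclic permutation $\tau=(\tau_0,\ldots,\tau_{N-1})$ of $[N]$ is cyclic meandric if the two alternating matchings $\{\{\tau_0,\tau_1\},\{\tau_2,\tau_3\},\ldots,\{\tau_{N-2},\tau_{N-1}\}\}$ and $\{\{\tau_1,\tau_2\},\{\tau_3,\tau_4\},\ldots,\{\tau_{N-1},\tau_0\}\}$ are both non-crossing. For $S\subset[N]$, the first-return permutation of $\tau$ on $S$ is obtained by reading $\tau$ cyclically, deleting all letters outside $S$, and relabelling the elements of $S$ increasingly by $0,\ldots,|S|-1$; it is a cyclic permutation of $[|S|]$. The meander number $\mu(\sigma)$ of a cyclic permutation $\sigma$ of $[n]$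 is the least even $N$ for which there is a cyclic meandric permutation of $[N]$ whose first-return permutation on some $n$-element subset of $[N]$ is $\sigma$. *)

theory Defs
  imports Complex_Main "HOL-Combinatorics.Combinatorics"
begin

text \<open>A permutation of \<open>{..<n}\<close> is extended by the identity to all of \<open>nat\<close>.\<close>

definition cyclic_permutation :: "nat \<Rightarrow> (nat \<Rightarrow> nat) \<Rightarrow> bool" where
  "cyclic_permutation n \<sigma> \<longleftrightarrow> \<sigma> permutes {..<n} \<and> cyclic_on \<sigma> {..<n}"

text \<open>The list \<open>ts\<close> is determined by \<open>\<sigma>\<close> only up to rotation, so this is a relation.
  It agrees with \<open>cyclic_permutation\<close>, and the notions below do not depend on
  the chosen rotation; see the lemmas at the end of the theory.\<close>

definition cycle_notation :: "nat \<Rightarrow> (nat \<Rightarrow> nat) \<Rightarrow> nat list \<Rightarrow> bool" where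
  "cycle_notation n \<sigma> ts \<longleftrightarrow> distinct ts \<and> set ts = {..<n} \<and> \<sigma> = cycle_of_list ts"

definition noncrossing :: "nat set set \<Rightarrow> bool" where
  "noncrossing M \<longleftrightarrow>
     \<not> (\<exists>a\<^sub>1 b\<^sub>1 a\<^sub>2 b\<^sub>2. {a\<^sub>1, b\<^sub>1} \<in> M \<and> {a\<^sub>2, b\<^sub>2} \<in> M \<and> a\<^sub>1 < a\<^sub>2 \<and> a\<^sub>2 < b\<^sub>1 \<and> b\<^sub>1 < b\<^sub>2)"

definition even_matching :: "nat list \<Rightarrow> nat set set" where
  "even_matching ts = {{ts ! (2 * i), ts ! (2 * i + 1)} | i. 2 * i + 1 < length ts}"

definition odd_matching :: "nat list \<Rightarrow> nat set set" where
  "odd_matching ts =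
     {{ts ! (2 * i + 1), ts ! ((2 * i + 2) mod length ts)} | i. 2 * i + 1 < length ts}"

definition cyclic_meandric :: "nat \<Rightarrow> (nat \<Rightarrow> nat) \<Rightarrow> bool" where
  "cyclic_meandric N \<tau> \<longleftrightarrow> even N \<and> N > 0 \<and> cyclic_permutation N \<tau> \<and>
     (\<exists>ts. cycle_notation N \<tau> ts \<and> noncrossing (even_matching ts) \<and> noncrossing (odd_matching ts))"

text \<open>The increasing bijection from a finite set \<open>S\<close> onto \<open>{..<card S}\<close>.\<close>

definition relabel :: "nat set \<Rightarrow> nat \<Rightarrow> nat" where
  "relabel S x = card {y \<in> S. y < x}"

definition first_return_list :: "nat list \<Rightarrow> nat set \<Rightarrow> nat list" where
  "first_return_list ts S = map (relabel S) (filter (\<lambda>x. x \<in> S) ts)"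

definition is_first_return :: "nat \<Rightarrow> (nat \<Rightarrow> nat) \<Rightarrow> nat set \<Rightarrow> (nat \<Rightarrow> nat) \<Rightarrow> bool" where
  "is_first_return N \<tau> S \<sigma> \<longleftrightarrow>
     (\<exists>ts. cycle_notation N \<tau> ts \<and> cycle_notation (card S) \<sigma> (first_return_list ts S))"

text \<open>\<open>LEAST\<close> is unspecified on an empty set. For a cyclic permutation of \<open>{..<n}\<close> with \<open>n > 0\<close>
  the set of such \<open>N\<close> is never empty, but this is not needed for the definition.
  The argument \<open>n\<close> is not redundant: \<open>id\<close> permutes every \<open>{..<n}\<close>.\<close>

definition meander_number :: "nat \<Rightarrow> (nat \<Rightarrow> nat) \<Rightarrow> nat" where
  "meander_number n \<sigma> =
     (LEAST N. even N \<and>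
        (\<exists>\<tau> S. cyclic_meandric N \<tau> \<and> S \<subseteq> {..<N} \<and> card S = n \<and> is_first_return N \<tau> S \<sigma>))"

lemma funpow_cycle_of_list_nth:
  assumes "distinct ts" "i < length ts"
  shows "(cycle_of_list ts ^^ k) (ts ! i) = ts ! ((i + k) mod length ts)"
proof -
  have "(cycle_of_list ts ^^ k) (ts ! i) = map (cycle_of_list ts ^^ k) ts ! i"
    using assms(2) by simp
  also have "\<dots> = rotate k ts ! i"
    by (simp only: cyclic_rotation[OF assms(1)])
  also have "\<dots> = ts ! ((i + k) mod length ts)"
    using assms(2) by (simp add: nth_rotate add.commute)
  finally show ?thesis .
qed

lemma length_cycle_notation:
  assumes "cycle_notation n \<sigma> ts"
  shows "length ts = n"
  using assms unfolding cycle_notation_def by (metis card_lessThan distinct_card)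

lemma cyclic_permutation_iff_cycle_notation:
  assumes "n > 0"
  shows "cyclic_permutation n \<sigma> \<longleftrightarrow> (\<exists>ts. cycle_notation n \<sigma> ts)"
proof
  assume A: "cyclic_permutation n \<sigma>"
  then have perm: "\<sigma> permutes {..<n}" and cyc: "cyclic_on \<sigma> {..<n}"
    by (auto simp: cyclic_permutation_def)
  have p: "permutation \<sigma>" using perm by (auto simp: permutation_permutes)
  let ?ts = "support \<sigma> 0"
  have "set ?ts = range (\<lambda>i. (\<sigma> ^^ i) 0)" by (rule support_set[OF p])
  also have "\<dots> = orbit \<sigma> 0" using orbit_altdef_permutation[OF p] by auto
  also have "\<dots> = {..<n}" using cyc assms by (auto simp: cyclic_on_alldef)
  finally have s: "set ?ts = {..<n}" .
  have "\<sigma> x = cycle_of_list ?ts x" for x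
  proof (cases "x \<in> set ?ts")
    case True
    then show ?thesis by (rule cycle_restrict[OF p])
  next
    case False
    then have "x \<notin> {..<n}" using s by blast
    then have "\<sigma> x = x" using perm by (auto simp: permutes_def)
    then show ?thesis using id_outside_supp[OF False] by simp
  qed
  then have "\<sigma> = cycle_of_list ?ts" by (rule ext)
  with s cycle_of_permutation[OF p] show "\<exists>ts. cycle_notation n \<sigma> ts"
    unfolding cycle_notation_def by blast
next
  assume "\<exists>ts. cycle_notation n \<sigma> ts"
  then obtain ts where ts: "cycle_notation n \<sigma> ts" ..
  note len = length_cycle_notation[OF ts]
  have d: "distinct ts" and s: "set ts = {..<n}" and e: "\<sigma> = cycle_of_list ts"
    using ts by (auto simp: cycle_notation_def)
  have perm: "\<sigma> permutes {..<n}" using cycle_permutes[of ts] s e by simp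
  then have p: "permutation \<sigma>" by (auto simp: permutation_permutes)
  have f: "(\<sigma> ^^ k) (ts ! 0) = ts ! (k mod n)" for k
    using funpow_cycle_of_list_nth[OF d, of 0 k] assms len e by simp
  have "orbit \<sigma> (ts ! 0) = {ts ! (k mod n) | k. True}"
    using orbit_altdef_permutation[OF p] f by auto
  also have "\<dots> = set ts"
  proof
    show "{ts ! (k mod n) | k. True} \<subseteq> set ts" using assms len by auto
    show "set ts \<subseteq> {ts ! (k mod n) | k. True}"
    proof
      fix x assume "x \<in> set ts"
      then obtain k where "k < n" "x = ts ! k" using len by (auto simp: in_set_conv_nth)
      then have "x = ts ! (k mod n)" by simp
      then show "x \<in> {ts ! (k mod n) | k. True}" by blast
    qed
  qed
  finally have "{..<n} = orbit \<sigma> (ts ! 0)" using s by simp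
  moreover have "ts ! 0 \<in> {..<n}" using assms len s nth_mem by blast
  ultimately have "cyclic_on \<sigma> {..<n}" by (rule cyclic_on_singleI[rotated])
  with perm show "cyclic_permutation n \<sigma>" by (simp add: cyclic_permutation_def)
qed

lemma cycle_notation_rotate:
  assumes "cycle_notation n \<sigma> ts"
  shows "cycle_notation n \<sigma> (rotate k ts)"
  using assms cycle_of_list_rotate_independent[of ts k] by (simp add: cycle_notation_def)

lemma cycle_notation_unique:
  assumes ts: "cycle_notation n \<sigma> ts" and us: "cycle_notation n \<sigma> us"
  shows "\<exists>k. us = rotate k ts"
proof (cases "n = 0")
  case True
  then show ?thesis
    using length_cycle_notation[OF ts] length_cycle_notation[OF us] by simp
next
  case False
  note len = length_cycle_notation[OF ts] length_cycle_notation[OF us]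
  have "us ! 0 \<in> set us" using False len(2) by simp
  also have "set us = set ts" using ts us by (simp add: cycle_notation_def)
  finally obtain j where j: "j < n" "us ! 0 = ts ! j"
    using len(1) by (auto simp: in_set_conv_nth)
  have "us = rotate j ts"
  proof (rule nth_equalityI)
    show "length us = length (rotate j ts)" using len by simp
    fix i assume "i < length us"
    then have i: "i < n" using len by simp
    have "us ! i = (\<sigma> ^^ i) (us ! 0)"
      using funpow_cycle_of_list_nth[of us 0 i] us i len(2) by (simp add: cycle_notation_def)
    also have "\<dots> = ts ! ((j + i) mod n)"
      using funpow_cycle_of_list_nth[of ts j i] ts j len(1) by (simp add: cycle_notation_def)
    also have "\<dots> = rotate j ts ! i" using i len(1) by (simp add: nth_rotate)
    finally show "us ! i = rotate j ts ! i" .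
  qed
  then show ?thesis ..
qed

lemma matching_rotate1:
  assumes "even (length ts)"
  shows "even_matching (rotate1 ts) = odd_matching ts"
    and "odd_matching (rotate1 ts) = even_matching ts"
proof -
  let ?N = "length ts"
  have r: "rotate1 ts ! k = ts ! (Suc k mod ?N)" if "k < ?N" for k
    using that by (rule nth_rotate1)
  have e: "{rotate1 ts ! (2 * i), rotate1 ts ! (2 * i + 1)} =
      {ts ! (2 * i + 1), ts ! ((2 * i + 2) mod ?N)}" if "2 * i + 1 < ?N" for i
    using that r[of "2 * i"] r[of "2 * i + 1"] by simp
  have "X \<in> even_matching (rotate1 ts) \<longleftrightarrow> X \<in> odd_matching ts" for X
    unfolding even_matching_def odd_matching_def length_rotate1 mem_Collect_eq
    using e by blast
  then show "even_matching (rotate1 ts) = odd_matching ts" by blast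
  have m: "{rotate1 ts ! (2 * i + 1), rotate1 ts ! ((2 * i + 2) mod ?N)} =
      {ts ! (2 * ((i + 1) mod (?N div 2))), ts ! (2 * ((i + 1) mod (?N div 2)) + 1)}"
    (is "?L = ?R") if i: "2 * i + 1 < ?N" for i
  proof -
    have N: "?N = 2 * (?N div 2)" using assms by simp
    have "(2 * i + 2) mod ?N = 2 * ((i + 1) mod (?N div 2))"
      using mult_mod_right[of 2 "i + 1" "?N div 2"] N by simp
    moreover have "2 * ((i + 1) mod (?N div 2)) + 1 < ?N"
    proof -
      have "?N div 2 > 0" using i N by linarith
      then have "(i + 1) mod (?N div 2) < ?N div 2" by simp
      then show ?thesis using N by linarith
    qed
    ultimately show ?thesis
      using i r[of "2 * i + 1"] r[of "2 * ((i + 1) mod (?N div 2))"] by simp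
  qed
  show "odd_matching (rotate1 ts) = even_matching ts"
  proof (intro equalityI subsetI)
    fix X assume "X \<in> odd_matching (rotate1 ts)"
    then obtain i where i: "2 * i + 1 < ?N"
      and X: "X = {rotate1 ts ! (2 * i + 1), rotate1 ts ! ((2 * i + 2) mod ?N)}"
      by (auto simp: odd_matching_def)
    let ?j = "(i + 1) mod (?N div 2)"
    have "?j < ?N div 2" using i by simp
    then have "2 * ?j + 1 < ?N" by linarith
    with X m[OF i] show "X \<in> even_matching ts"
      unfolding even_matching_def by blast
  next
    fix X assume "X \<in> even_matching ts"
    then obtain j where j: "2 * j + 1 < ?N" and X: "X = {ts ! (2 * j), ts ! (2 * j + 1)}"
      by (auto simp: even_matching_def)
    define i where "i = (if j = 0 then ?N div 2 - 1 else j - 1)"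
    have i: "2 * i + 1 < ?N" using j assms by (auto simp: i_def elim: evenE)
    have "(i + 1) mod (?N div 2) = j" using j by (auto simp: i_def)
    with X m[OF i]
    have "X = {rotate1 ts ! (2 * i + 1), rotate1 ts ! ((2 * i + 2) mod length (rotate1 ts))}"
      by simp
    moreover have "2 * i + 1 < length (rotate1 ts)" using i by simp
    ultimately show "X \<in> odd_matching (rotate1 ts)"
      unfolding odd_matching_def by blast
  qed
qed

lemma first_return_list_rotate:
  "\<exists>l. first_return_list (rotate k ts) S = rotate l (first_return_list ts S)"
proof (induction k)
  case 0
  then show ?case by (intro exI[of _ 0]) simp
next
  case (Suc k)
  have *: "\<exists>l. first_return_list (rotate1 xs) S = rotate l (first_return_list xs S)" for xs
  proof (cases xs)
    case Nil
    then show ?thesis by (simp add: first_return_list_def)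
  next
    case (Cons y ys)
    show ?thesis
    proof (cases "y \<in> S")
      case True
      then show ?thesis using Cons by (intro exI[of _ 1]) (simp add: first_return_list_def)
    next
      case False
      then show ?thesis using Cons by (intro exI[of _ 0]) (simp add: first_return_list_def)
    qed
  qed
  obtain l where "first_return_list (rotate k ts) S = rotate l (first_return_list ts S)"
    using Suc.IH by blast
  moreover obtain l' where
    "first_return_list (rotate1 (rotate k ts)) S = rotate l' (first_return_list (rotate k ts) S)"
    using * by blast
  ultimately have "first_return_list (rotate (Suc k) ts) S = rotate (l' + l) (first_return_list ts S)"
    by (simp add: rotate_rotate)
  then show ?case ..
qed

lemma is_first_return_unique:
  assumes "is_first_return N \<tau> S \<sigma>" "is_first_return N \<tau> S \<sigma>'"
  shows "\<sigma> = \<sigma>'"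
proof -
  obtain ts us where ts: "cycle_notation N \<tau> ts" "cycle_notation (card S) \<sigma> (first_return_list ts S)"
    and us: "cycle_notation N \<tau> us" "cycle_notation (card S) \<sigma>' (first_return_list us S)"
    using assms by (auto simp: is_first_return_def)
  obtain k where "us = rotate k ts" using cycle_notation_unique[OF ts(1) us(1)] ..
  then obtain l where "first_return_list us S = rotate l (first_return_list ts S)"
    using first_return_list_rotate by blast
  with us(2) ts(2) cycle_of_list_rotate_independent[of "first_return_list ts S" l] show ?thesis
    by (simp add: cycle_notation_def)
qed

end

theory Submission
  imports Defs
begin

text \<open>Let \<open>m\<close> be about the square root of \<open>n L(n)\<close>, and let \<open>\<sigma>\<^sub>n\<close> visit \<open>0, \<dots>, n - m - 1\<close> in order and then
  the last \<open>m\<close> elements in the order of a list \<open>es\<close> such that no balanced subset of them has few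
  boundary points both in the natural order and in \<open>es\<close>; counting shows that almost all \<open>es\<close> qualify.

  Upper bound: in an \<open>m \<times> m\<close> grid let the line follow the columns and the curve follow the rows, both
  alternating in direction. Any order of \<open>m\<close> points is realised by choosing one crossing in each row
  and column, so \<open>m\<^sup>2\<close> crossings suffice; the remaining points come from wiggling the curve around
  the line at the first crossing.

  Lower bound: the line and the curve of a meander of size \<open>N\<close> form a plane graph of degree \<open>4\<close> on \<open>N\<close>
  vertices. The argument of Lipton and Tarjan yields a set of vertices that splits the \<open>m\<close> points in a balanced
  way but is left by the line and the curve only \<open>O(\<surd>N)\<close> times, so \<open>\<surd>N\<close> is at least of order \<open>m\<close>.
  Topology enters only through two combinatorial facts: a cut crosses the boundary of each face an
  even number of times, and Euler's formula.\<close>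

section \<open>Separators in plane graphs\<close>

text \<open>The lower bound controls mu itself, in the form m^2 = O(mu), while the claim is about mu
  - n. This suffices because m^2 is of order n L(n) and L tends to infinity, so that n is eventually
  a small fraction of it. A set is compared with two orders at once, by how often each of them
  leaves it. The separator is therefore a cut of edges, and the Lipton-Tarjan argument runs with
  graph and dual exchanged: the breadth-first tree lives on the faces, its fundamental cycles are
  edge cuts of the meander graph, and degree 4 takes the place of a triangulation in the balancing
  step. Random orders work because a balanced subset has at least 2^(m/10) equally likely patterns,
  while for large m fewer than the square root of that many words have at most m/300 changes. One
  square root pays for the choice of the subset, the other for its pattern in
  \<open>es\<close>.\<close>

lemma even_card_sym_diff:
  assumes "finite A" "finite B"
  shows "even (card (A - B \<union> (B - A))) \<longleftrightarrow> (even (card A) \<longleftrightarrow> even (card B))"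
proof -
  have "card A = card (A - B) + card (A \<inter> B)" "card B = card (B - A) + card (A \<inter> B)"
    using assms by (metis card_Diff_subset_Int card_mono finite_Int inf_le1 le_add_diff_inverse2,
      metis assms(2) card_Diff_subset_Int card_mono finite_Int inf.commute inf_le2 le_add_diff_inverse2)
  moreover have "card (A - B \<union> (B - A)) = card (A - B) + card (B - A)"
    using assms by (intro card_Un_disjoint) auto
  ultimately show ?thesis by simp presburger
qed

section \<open>Cuts and face boundaries modulo 2\<close>

locale embedded_multigraph =
  fixes E :: "'e set" and h0 h1 :: "'e \<Rightarrow> 'v" and f0 f1 :: "'e \<Rightarrow> 'f"
begin

definition cut :: "'v set \<Rightarrow> 'e set" where
  "cut X = {e \<in> E. (h0 e \<in> X) \<noteq> (h1 e \<in> X)}"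

text \<open>The boundary of a face modulo 2: an edge with the same face on both sides belongs to no
  \<open>inc \<phi>\<close>.\<close>

definition inc :: "'f \<Rightarrow> 'e set" where
  "inc \<phi> = {e \<in> E. (f0 e = \<phi>) \<noteq> (f1 e = \<phi>)}"

end

text \<open>Each vertex meets each face in an even number of edge sides (\<open>local_even\<close>), which is all that is
  needed to see a cut as a cycle of the dual graph. The functions \<open>lev\<close>, \<open>par\<close> and \<open>up\<close> describe a
  breadth-first spanning tree of the dual graph, and \<open>d v\<close> approximates the level of the faces at \<open>v\<close>.\<close>

locale levelled_plane_graph = embedded_multigraph E h0 h1 f0 f1
  for E :: "'e set" and h0 h1 :: "'e \<Rightarrow> 'v" and f0 f1 :: "'e \<Rightarrow> 'f" +
  fixes V :: "'v set" and F :: "'f set" and root :: 'f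
    and lev :: "'f \<Rightarrow> nat" and par :: "'f \<Rightarrow> 'e" and up :: "'f \<Rightarrow> 'f" and d :: "'v \<Rightarrow> nat"
  assumes fin: "finite V" "finite E" "finite F"
    and V_ne: "V \<noteq> {}"
    and h: "e \<in> E \<Longrightarrow> h0 e \<in> V" "e \<in> E \<Longrightarrow> h1 e \<in> V"
    and local_even: "v \<in> V \<Longrightarrow> even (card (cut {v} \<inter> inc \<phi>))"
    and conn: "X \<subseteq> V \<Longrightarrow> cut X = {} \<Longrightarrow> X = {} \<or> X = V"
    and degree: "v \<in> V \<Longrightarrow> card (cut {v}) \<le> 4"
    and root: "root \<in> F"
    and euler: "card E + 2 \<le> card V + card F"
    and par: "\<phi> \<in> F \<Longrightarrow> \<phi> \<noteq> root \<Longrightarrow> par \<phi> \<in> E"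
      "\<phi> \<in> F \<Longrightarrow> \<phi> \<noteq> root \<Longrightarrow> {f0 (par \<phi>), f1 (par \<phi>)} = {\<phi>, up \<phi>}"
      "\<phi> \<in> F \<Longrightarrow> \<phi> \<noteq> root \<Longrightarrow> lev \<phi> = lev (up \<phi>) + 1"
    and near: "e \<in> E \<Longrightarrow> v \<in> {h0 e, h1 e} \<Longrightarrow> \<phi> \<in> {f0 e, f1 e} \<Longrightarrow>
      lev \<phi> \<le> d v + 2 \<and> d v \<le> lev \<phi> + 2"
begin

lemma finite_cut [simp]: "finite (cut X)"
  using fin by (simp add: cut_def)

lemma cut_sym_diff: "cut (X - Y \<union> (Y - X)) = cut X - cut Y \<union> (cut Y - cut X)"
  by (auto simp: cut_def)

lemma cut_compl: "X \<subseteq> V \<Longrightarrow> cut (V - X) = cut X"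
  using h by (auto simp: cut_def)

lemma cut_empty [simp]: "cut {} = {}"
  by (auto simp: cut_def)

text \<open>Modulo 2 the cut of a set is the sum of the cuts of its points, so the condition at
  single vertices propagates. In the dual graph, cuts are even subgraphs.\<close>

lemma cut_even: "X \<subseteq> V \<Longrightarrow> even (card (cut X \<inter> inc \<phi>))"
proof (induction X rule: infinite_finite_induct)
  case (infinite A)
  then show ?case using fin finite_subset by blast
next
  case empty
  then show ?case by simp
next
  case (insert x X)
  have "insert x X = {x} - X \<union> (X - {x})" using insert.hyps by auto
  then have "cut (insert x X) = cut {x} - cut X \<union> (cut X - cut {x})"
    using cut_sym_diff by metis
  then have "cut (insert x X) \<inter> inc \<phi> =
      (cut {x} \<inter> inc \<phi>) - (cut X \<inter> inc \<phi>) \<union> ((cut X \<inter> inc \<phi>) - (cut {x} \<inter> inc \<phi>))" by auto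
  then show ?case
    using even_card_sym_diff[of "cut {x} \<inter> inc \<phi>" "cut X \<inter> inc \<phi>"] local_even insert by simp
qed

section \<open>The dual tree and its complementary edges\<close>

definition T where "T = par ` (F - {root})"
definition R where "R = E - T"

lemma inj_par: "inj_on par (F - {root})"
proof (rule inj_onI)
  fix a b assume ab: "a \<in> F - {root}" "b \<in> F - {root}" "par a = par b"
  show "a = b"
  proof (rule ccontr)
    assume "a \<noteq> b"
    then have "a = up b" "b = up a" using par(2)[of a] par(2)[of b] ab by (auto simp: doubleton_eq_iff)
    then show False using par(3)[of a] par(3)[of b] ab by simp
  qed
qed

lemma T_subset: "T \<subseteq> E"
  using par by (auto simp: T_def)

lemma par_inc: "\<phi> \<in> F \<Longrightarrow> \<phi> \<noteq> root \<Longrightarrow> par \<phi> \<in> inc \<psi> \<longleftrightarrow> \<psi> = \<phi> \<or> \<psi> = up \<phi>"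
proof -
  assume a: "\<phi> \<in> F" "\<phi> \<noteq> root"
  have "\<phi> \<noteq> up \<phi>" using par(3)[OF a] by (metis add.right_neutral nat_add_left_cancel_less less_irrefl less_add_one)
  then show ?thesis using par(1)[OF a] par(2)[OF a]
    unfolding inc_def by (auto simp: doubleton_eq_iff)
qed

text \<open>Together with \<open>cut_R_empty\<close> this makes \<open>R\<close> a spanning tree on
  the vertices, complementary to the dual tree \<open>T\<close>.\<close>

lemma card_R: "card R \<le> card V - 1"
proof -
  have "card T = card F - 1"
    unfolding T_def using card_image[OF inj_par] root fin by simp
  moreover have "card R = card E - card T"
    unfolding R_def using T_subset fin by (intro card_Diff_subset) (auto intro: finite_subset)
  moreover have "card F > 0" using root fin by (auto simp: card_gt_0_iff)
  ultimately show ?thesis using euler by linarith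
qed

text \<open>A cut contained in the tree would have a deepest edge, and the lower face of that edge would be
  met by the cut exactly once.\<close>

lemma cut_in_tree:
  assumes "X \<subseteq> V" "cut X \<subseteq> T"
  shows "X = {} \<or> X = V"
proof (rule ccontr)
  assume "\<not> ?thesis"
  then have "cut X \<noteq> {}" using conn assms by blast
  define C where "C = {\<phi> \<in> F - {root}. par \<phi> \<in> cut X}"
  have "finite C" "C \<noteq> {}" using fin assms \<open>cut X \<noteq> {}\<close> by (auto simp: C_def T_def)
  then have "finite (lev ` C)" "lev ` C \<noteq> {}" by auto
  then have "Max (lev ` C) \<in> lev ` C" by (rule Max_in)
  then obtain \<phi> where \<phi>: "\<phi> \<in> C" "lev \<phi> = Max (lev ` C)" by auto
  then have max: "lev \<psi> \<le> lev \<phi>" if "\<psi> \<in> C" for \<psi>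
    using that \<open>finite C\<close> by simp
  have "cut X \<inter> inc \<phi> = {par \<phi>}"
  proof (intro equalityI subsetI)
    fix e assume e: "e \<in> cut X \<inter> inc \<phi>"
    then obtain \<psi> where \<psi>: "\<psi> \<in> C" "e = par \<psi>" using assms by (auto simp: C_def T_def)
    then have "\<phi> = \<psi> \<or> \<phi> = up \<psi>" using e par_inc[of \<psi> \<phi>] by (auto simp: C_def)
    then show "e \<in> {par \<phi>}" using max[OF \<psi>(1)] par(3)[of \<psi>] \<psi> by (auto simp: C_def)
  next
    fix e assume "e \<in> {par \<phi>}"
    then show "e \<in> cut X \<inter> inc \<phi>" using \<phi> par_inc[of \<phi> \<phi>] by (auto simp: C_def)
  qed
  then show False using cut_even[OF assms(1), of \<phi>] by simp
qed

lemma cut_R_empty: "X \<subseteq> V \<Longrightarrow> cut X \<inter> R = {} \<Longrightarrow> X = {} \<or> X = V"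
  by (rule cut_in_tree) (auto simp: R_def cut_def)

text \<open>Up to complement, a vertex set is determined by the part of its cut in \<open>R\<close>. There are
  \<open>2 ^ (card V - 1)\<close> sets up to complement and by Euler's formula at most that many subsets of \<open>R\<close>, so
  every subset of \<open>R\<close> arises.\<close>

lemma fundamental_cut:
  assumes "e \<in> R"
  shows "\<exists>X \<subseteq> V. cut X \<inter> R = {e}"
proof -
  obtain v where v: "v \<in> V" using V_ne by auto
  define G where "G X = cut X \<inter> R" for X
  have fR: "finite R" using fin by (simp add: R_def)
  have inj: "inj_on G (Pow (V - {v}))"
  proof (rule inj_onI)
    fix X Y assume XY: "X \<in> Pow (V - {v})" "Y \<in> Pow (V - {v})" "G X = G Y"
    let ?D = "X - Y \<union> (Y - X)"
    have "cut ?D \<inter> R = {}" using XY(3) unfolding cut_sym_diff G_def by blast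
    then have "?D = {} \<or> ?D = V" using XY by (intro cut_R_empty) auto
    then show "X = Y" using XY v by auto
  qed
  have "card (G ` Pow (V - {v})) = 2 ^ (card V - 1)"
    using card_image[OF inj] fin v by (simp add: card_Pow)
  also have "\<dots> \<ge> card (Pow R)" using card_R fR by (simp add: card_Pow)
  finally have "card (Pow R) \<le> card (G ` Pow (V - {v}))" .
  moreover have "G ` Pow (V - {v}) \<subseteq> Pow R" by (auto simp: G_def)
  ultimately have "G ` Pow (V - {v}) = Pow R"
    using fR by (intro card_seteq) auto
  moreover have "{e} \<in> Pow R" using assms by simp
  ultimately have "{e} \<in> G ` Pow (V - {v})" by metis
  then show ?thesis by (auto simp: G_def)
qed

text \<open>In the dual, \<open>cut X\<close> is the fundamental cycle of \<open>e\<close>: this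
  edge and tree paths climbing from its two faces, so each level is used at most twice. The
  induction runs from the deepest level towards the root.\<close>

lemma tree_edges_per_level:
  assumes "X \<subseteq> V" "cut X \<inter> R = {e}"
  shows "card {\<phi> \<in> F - {root}. lev \<phi> = l \<and> par \<phi> \<in> cut X} \<le> 2"
proof -
  define C where "C l = {\<phi> \<in> F - {root}. lev \<phi> = l \<and> par \<phi> \<in> cut X}" for l
  define D where "D l = {\<phi> \<in> {f0 e, f1 e}. l \<le> lev \<phi>}" for l
  define B where "B = Suc (Max (lev ` F))"
  have fC: "finite (C l)" for l using fin by (simp add: C_def)
  have CB: "C l = {}" if "l \<ge> B" for l
  proof -
    have "lev \<phi> < B" if "\<phi> \<in> F" for \<phi> using that fin by (simp add: B_def less_Suc_eq_le)
    then show ?thesis using that by (force simp: C_def)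
  qed
  \<comment> \<open>By parity, a face whose parent edge is cut meets a second cut edge; this is
    \<open>e\<close> or the parent edge of a face one level deeper.\<close>
  have step: "C l \<subseteq> up ` C (Suc l) \<union> {\<phi> \<in> {f0 e, f1 e}. lev \<phi> = l}" for l
  proof
    fix \<phi> assume \<phi>: "\<phi> \<in> C l"
    then have p: "par \<phi> \<in> cut X \<inter> inc \<phi>" using par_inc[of \<phi> \<phi>] by (auto simp: C_def)
    have "cut X \<inter> inc \<phi> \<noteq> {par \<phi>}" using cut_even[OF assms(1), of \<phi>] by auto
    then obtain e' where e': "e' \<in> cut X" "e' \<in> inc \<phi>" "e' \<noteq> par \<phi>" using p by blast
    show "\<phi> \<in> up ` C (Suc l) \<union> {\<phi> \<in> {f0 e, f1 e}. lev \<phi> = l}"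
    proof (cases "e' \<in> R")
      case True
      then have "e' = e" using e' assms by blast
      then show ?thesis using e' \<phi> by (auto simp: inc_def C_def)
    next
      case False
      then have "e' \<in> T" using e' by (auto simp: R_def cut_def)
      then obtain \<psi> where \<psi>: "\<psi> \<in> F - {root}" "e' = par \<psi>" by (auto simp: T_def)
      then have "\<phi> = up \<psi>" using e' par_inc[of \<psi> \<phi>] by auto
      then have "\<psi> \<in> C (Suc l)" using \<psi> par(3)[of \<psi>] \<phi> e' by (auto simp: C_def)
      then show ?thesis using \<open>\<phi> = up \<psi>\<close> by blast
    qed
  qed
  have "card (C l) \<le> card (D l)" for l
  proof (cases "l \<ge> B")
    case True
    then show ?thesis using CB by simp
  next
    case False
    then have "l \<le> B" by simp
    then show ?thesis
    proof (induction l rule: inc_induct)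
      case base
      then show ?case using CB by simp
    next
      case (step l)
      let ?D = "{\<phi> \<in> {f0 e, f1 e}. lev \<phi> = l}"
      have "card (C l) \<le> card (up ` C (Suc l) \<union> ?D)"
        using \<open>C l \<subseteq> _\<close> fC by (intro card_mono) auto
      also have "\<dots> \<le> card (up ` C (Suc l)) + card ?D" by (rule card_Un_le)
      also have "\<dots> \<le> card (C (Suc l)) + card ?D" using card_image_le[OF fC] by simp
      also have "\<dots> \<le> card (D (Suc l)) + card ?D" using step.IH by simp
      also have "\<dots> = card (D (Suc l) \<union> ?D)"
        by (subst card_Un_disjoint) (auto simp: D_def)
      also have "D (Suc l) \<union> ?D = D l" by (auto simp: D_def)
      finally show ?case .
    qed
  qed
  also have "card (D l) \<le> card {f0 e, f1 e}" for l by (intro card_mono) (auto simp: D_def)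
  also have "card {f0 e, f1 e} \<le> 2" by (simp add: card_insert_if)
  finally show ?thesis by (simp add: C_def)
qed

lemma side_unique:
  assumes "X \<subseteq> V" "Y \<subseteq> V" "v \<in> V" "v \<notin> X" "v \<notin> Y" "cut X \<inter> R = cut Y \<inter> R"
  shows "X = Y"
proof -
  let ?D = "X - Y \<union> (Y - X)"
  have "cut ?D \<inter> R = {}" using assms(6) unfolding cut_sym_diff by blast
  then have "?D = {} \<or> ?D = V" using assms by (intro cut_R_empty) auto
  then show ?thesis using assms by auto
qed

text \<open>As \<open>R\<close> is a spanning tree, the sets \<open>Y e\<close> are the components
  left when \<open>v\<close> is removed. The points in none of them form a set \<open>D\<close> that
  no edge of \<open>R\<close> leaves, so \<open>D\<close> is empty.\<close>

lemma branches:
  assumes v: "v \<in> V"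
  obtains Y where "\<And>e. e \<in> cut {v} \<inter> R \<Longrightarrow> Y e \<subseteq> V - {v} \<and> cut (Y e) \<inter> R = {e}"
    and "V - {v} = (\<Union>e \<in> cut {v} \<inter> R. Y e)"
proof -
  have "\<exists>Y \<subseteq> V - {v}. cut Y \<inter> R = {e}" if e: "e \<in> R" for e
  proof -
    obtain X where X: "X \<subseteq> V" "cut X \<inter> R = {e}" using fundamental_cut[OF e] by blast
    show ?thesis
    proof (cases "v \<in> X")
      case True
      then show ?thesis using X cut_compl[of X] by (intro exI[of _ "V - X"]) auto
    next
      case False
      then show ?thesis using X by blast
    qed
  qed
  then have "\<forall>e\<in>R. \<exists>Y. Y \<subseteq> V - {v} \<and> cut Y \<inter> R = {e}" by blast
  then obtain Y where Y: "\<And>e. e \<in> R \<Longrightarrow> Y e \<subseteq> V - {v} \<and> cut (Y e) \<inter> R = {e}"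
    using bchoice[of R] by metis
  define D where "D = V - {v} - (\<Union>e \<in> cut {v} \<inter> R. Y e)"
  have "cut D \<inter> R = {}"
  proof (rule ccontr)
    assume "\<not> ?thesis"
    then obtain e' where e': "e' \<in> cut D" "e' \<in> R" by blast
    then obtain a b where ab: "a \<in> D" "b \<notin> D" "{h0 e', h1 e'} = {a, b}" "e' \<in> E"
      by (auto simp: cut_def)
    have cut_iff: "e' \<in> cut X \<longleftrightarrow> (a \<in> X) \<noteq> (b \<in> X)" for X
      using ab by (auto simp: cut_def doubleton_eq_iff)
    have bV: "b \<in> V" using ab h[of e'] by (auto simp: doubleton_eq_iff)
    show False
    proof (cases "b = v")
      case True
      then have "e' \<in> cut {v} \<inter> R" using cut_iff ab e' by (auto simp: D_def)
      moreover from this have "a \<in> Y e'" using Y[of e'] cut_iff True by blast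
      ultimately show False using ab by (auto simp: D_def)
    next
      case False
      then obtain e where e: "e \<in> cut {v} \<inter> R" "b \<in> Y e" using ab bV by (auto simp: D_def)
      have "a \<notin> Y e" using ab e by (auto simp: D_def)
      then have "e' \<in> cut (Y e)" using cut_iff e by simp
      then have "e' = e" using e' e Y[of e] by blast
      then show False using e cut_iff[of "{v}"] False ab by (auto simp: D_def)
    qed
  qed
  then have "D = {} \<or> D = V" by (intro cut_R_empty) (auto simp: D_def)
  then have "D = {}" using v by (auto simp: D_def)
  then have "V - {v} = (\<Union>e \<in> cut {v} \<inter> R. Y e)" using Y by (auto simp: D_def)
  then show ?thesis using that[of Y] Y by blast
qed

text \<open>Each strict inequality is sharpened to \<open>n - 1\<close>. This integer slack of one
  unit per branch is what lets \<open>balanced_fundamental_cut\<close> start at two weighted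
  vertices.\<close>

lemma card_Int_UN_bound:
  assumes "finite I" "card I \<le> k" "finite W" "W \<subseteq> insert v (\<Union>i\<in>I. Y i)"
    and "\<And>i. i \<in> I \<Longrightarrow> 5 * card (W' \<inter> Y i) < n" "W \<subseteq> W'" "finite W'" "n > 0"
  shows "5 * card W + k \<le> 5 + k * n"
proof -
  have "card W \<le> card (insert v (\<Union>i\<in>I. W' \<inter> Y i))"
    using assms by (intro card_mono) auto
  also have "\<dots> \<le> Suc (card (\<Union>i\<in>I. W' \<inter> Y i))" by (rule card_insert_le_m1) auto
  also have "\<dots> \<le> Suc (\<Sum>i\<in>I. card (W' \<inter> Y i))"
    unfolding Suc_le_mono by (rule card_UN_le[OF assms(1)])
  finally have "5 * card W \<le> 5 + (\<Sum>i\<in>I. 5 * card (W' \<inter> Y i))"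
    unfolding sum_distrib_left[symmetric] by linarith
  also have "(\<Sum>i\<in>I. 5 * card (W' \<inter> Y i)) \<le> (\<Sum>i\<in>I. n - 1)"
    using assms(5) by (intro sum_mono) fastforce
  also have "\<dots> \<le> k * (n - 1)" using assms by simp
  finally show ?thesis using assms by (cases n) auto
qed

text \<open>Among the fundamental cuts having at least a fifth of the weight on one side, take one whose side
  is smallest: the other branches at its end point are then too light.\<close>

lemma balanced_fundamental_cut:
  assumes W: "W \<subseteq> V" "card W \<ge> 2"
  obtains X e where "X \<subseteq> V" "cut X \<inter> R = {e}" "card W \<le> 5 * card (W \<inter> X)"
    "5 * card (W \<inter> X) \<le> 3 * card W + 2"
proof -
  have fW: "finite W" using W fin finite_subset by blast
  define good where "good X \<longleftrightarrow> X \<subseteq> V \<and> (\<exists>e. cut X \<inter> R = {e}) \<and> card W \<le> 5 * card (W \<inter> X)" for X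
  obtain v where v: "v \<in> V" using V_ne by auto
  have "\<exists>X. good X"
  proof (rule ccontr)
    assume no: "\<not> ?thesis"
    obtain Y where Y: "\<And>e. e \<in> cut {v} \<inter> R \<Longrightarrow> Y e \<subseteq> V - {v} \<and> cut (Y e) \<inter> R = {e}"
      "V - {v} = (\<Union>e \<in> cut {v} \<inter> R. Y e)" using branches[OF v] by blast
    have "5 * card (W \<inter> Y e) < card W" if "e \<in> cut {v} \<inter> R" for e
    proof -
      have "Y e \<subseteq> V" "cut (Y e) \<inter> R = {e}" using Y(1)[OF that] by auto
      then show ?thesis using no unfolding good_def by (meson not_le)
    qed
    moreover have "card (cut {v} \<inter> R) \<le> 4"
      using degree[OF v] by (meson card_mono finite_cut inf_le1 order.trans)
    \<comment> \<open>If all branches at \<open>v\<close> were light, at most one weighted vertex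
      could exist.\<close>
    ultimately have "5 * card W + 4 \<le> 5 + 4 * card W"
      using W fW Y(2)
      by (intro card_Int_UN_bound[where I = "cut {v} \<inter> R" and W' = W and Y = Y and v = v]) auto
    then show False using W by simp
  qed
  then obtain X where X: "good X" "\<And>X'. good X' \<Longrightarrow> card X \<le> card X'"
    using ex_has_least_nat[of good _ card] by blast
  then obtain e where e: "cut X \<inter> R = {e}" and XV: "X \<subseteq> V" by (auto simp: good_def)
  have eE: "e \<in> cut X" using e by blast
  then obtain a u where a: "a \<in> X" "u \<notin> X" "{h0 e, h1 e} = {a, u}"
    by (auto simp: cut_def)
  have eE': "e \<in> E" using eE by (simp add: cut_def)
  have aV: "a \<in> V" using a XV by blast
  have cut_iff: "e \<in> cut S \<longleftrightarrow> (a \<in> S) \<noteq> (u \<in> S)" for S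
    using a eE' by (auto simp: cut_def doubleton_eq_iff)
  obtain Y where Y: "\<And>e. e \<in> cut {a} \<inter> R \<Longrightarrow> Y e \<subseteq> V - {a} \<and> cut (Y e) \<inter> R = {e}"
      "V - {a} = (\<Union>e \<in> cut {a} \<inter> R. Y e)" using branches[OF aV] by blast
  have ea: "e \<in> cut {a} \<inter> R" using cut_iff a e by blast
  let ?I = "cut {a} \<inter> R - {e}"
  \<comment> \<open>Seen from \<open>a\<close>, the branch across \<open>e\<close> is the far side.
    The at most three other branches lie strictly inside \<open>X\<close>, so minimality makes them
    light.\<close>
  have Ye: "Y e = V - X"
    using Y(1)[OF ea] XV a aV e cut_compl[OF XV] by (intro side_unique[of _ _ a]) auto
  have small: "5 * card (W \<inter> Y e') < card W" if e': "e' \<in> ?I" for e'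
  proof -
    have y: "Y e' \<subseteq> V - {a}" "cut (Y e') \<inter> R = {e'}" using Y(1) e' by auto
    define D where "D = Y e' \<inter> (V - X)"
    have "e \<notin> cut (Y e') \<inter> R" using y(2) e' by auto
    then have "e \<notin> cut (Y e')" using ea by simp
    then have "u \<notin> Y e'" using cut_iff y by blast
    then have "e \<notin> cut D" using cut_iff a by (auto simp: D_def)
    have "e' \<notin> cut X \<inter> R" unfolding e using e' by simp
    then have "e' \<notin> cut X" using e' by simp
    have "e' \<notin> cut D"
    proof
      assume D: "e' \<in> cut D"
      have "e' \<in> cut {a}" using e' by blast
      then have "a \<in> {h0 e', h1 e'}" by (auto simp: cut_def)
      then show False using D \<open>e' \<notin> cut X\<close> a h[of e'] unfolding cut_def D_def by auto
    qed
    have "cut D \<subseteq> cut (Y e') \<union> cut X" using h by (auto simp: cut_def D_def)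
    then have "cut D \<inter> R \<subseteq> {e, e'}" using y(2) e by blast
    then have "cut D \<inter> R = {}" using \<open>e \<notin> cut D\<close> \<open>e' \<notin> cut D\<close> by blast
    then have "D = {} \<or> D = V" by (intro cut_R_empty) (auto simp: D_def)
    then have "D = {}" using y aV by (auto simp: D_def)
    then have "Y e' \<subset> X" using y a by (auto simp: D_def)
    then have "card (Y e') < card X" using XV fin by (meson finite_subset psubset_card_mono)
    then have "\<not> good (Y e')" using X(2) by (meson not_le)
    moreover have "Y e' \<subseteq> V" using y(1) by blast
    ultimately show ?thesis using y(2) unfolding good_def by (meson not_le)
  qed
  have XU: "X \<subseteq> insert a (\<Union>e'\<in>?I. Y e')"
  proof
    fix x assume "x \<in> X"
    show "x \<in> insert a (\<Union>e'\<in>?I. Y e')"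
    proof (cases "x = a")
      case False
      then have "x \<in> V - {a}" using \<open>x \<in> X\<close> XV by blast
      then obtain e' where "e' \<in> cut {a} \<inter> R" "x \<in> Y e'" using Y(2) by blast
      moreover from this have "e' \<noteq> e" using Ye \<open>x \<in> X\<close> by blast
      ultimately show ?thesis by blast
    qed simp
  qed
  have "card (cut {a} \<inter> R) \<le> 4"
    using degree[OF aV] by (meson card_mono finite_cut inf_le1 order.trans)
  then have "card ?I \<le> 3" using ea by simp
  then have "5 * card (W \<inter> X) + 3 \<le> 5 + 3 * card W"
    using XU small W fW
    by (intro card_Int_UN_bound[where I = ?I and W' = W and Y = Y and v = a]) auto
  then show ?thesis using that[of X e] X(1) e by (auto simp: good_def)
qed

section \<open>Slabs of levels and the balanced separator\<close>

lemma card_cut_in_slab: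
  assumes X: "X \<subseteq> V" "cut X \<inter> R = {e}" and "lo \<le> hi"
    and Y: "Y = {v \<in> V. lo \<le> d v \<and> d v < hi}"
  shows "card {e' \<in> cut X. h0 e' \<in> Y \<and> h1 e' \<in> Y} \<le> 2 * (hi - lo + 4) + 1"
proof -
  define C where "C l = {\<phi> \<in> F - {root}. lev \<phi> = l \<and> par \<phi> \<in> cut X}" for l
  have fC: "finite (C l)" for l using fin by (simp add: C_def)
  \<comment> \<open>Apart from \<open>e\<close> these are parent edges of faces whose level is
    within 2 of the slab: at most \<open>hi - lo + 4\<close> levels, with at most two edges
    each.\<close>
  have "{e' \<in> cut X. h0 e' \<in> Y \<and> h1 e' \<in> Y} \<subseteq> insert e (par ` (\<Union>l\<in>{lo - 2..<hi + 2}. C l))"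
  proof
    fix e' assume "e' \<in> {e' \<in> cut X. h0 e' \<in> Y \<and> h1 e' \<in> Y}"
    then have e': "e' \<in> cut X" "h0 e' \<in> Y" "e' \<in> E" by (auto simp: cut_def)
    show "e' \<in> insert e (par ` (\<Union>l\<in>{lo - 2..<hi + 2}. C l))"
    proof (cases "e' \<in> R")
      case True
      then show ?thesis using e' X by blast
    next
      case False
      then obtain \<phi> where \<phi>: "\<phi> \<in> F - {root}" "e' = par \<phi>" using e' by (auto simp: R_def T_def)
      then have "\<phi> \<in> {f0 e', f1 e'}" using par(2)[of \<phi>] by blast
      then have "lev \<phi> \<le> d (h0 e') + 2 \<and> d (h0 e') \<le> lev \<phi> + 2"
        using near[of e' "h0 e'" \<phi>] e' by blast
      then have "lev \<phi> \<in> {lo - 2..<hi + 2}" using e' Y by auto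
      moreover have "\<phi> \<in> C (lev \<phi>)" using \<phi> e' by (auto simp: C_def)
      ultimately show ?thesis using \<phi> by blast
    qed
  qed
  then have "card {e' \<in> cut X. h0 e' \<in> Y \<and> h1 e' \<in> Y} \<le>
      card (insert e (par ` (\<Union>l\<in>{lo - 2..<hi + 2}. C l)))"
    using fC by (intro card_mono) auto
  also have "\<dots> \<le> Suc (card (par ` (\<Union>l\<in>{lo - 2..<hi + 2}. C l)))"
    by (rule card_insert_le_m1) auto
  also have "\<dots> \<le> Suc (card (\<Union>l\<in>{lo - 2..<hi + 2}. C l))"
    using fC by (simp add: card_image_le)
  also have "\<dots> \<le> Suc (\<Sum>l\<in>{lo - 2..<hi + 2}. card (C l))"
    unfolding Suc_le_mono by (rule card_UN_le) simp
  also have "\<dots> \<le> Suc (\<Sum>l\<in>{lo - 2..<hi + 2}. 2)"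
    using tree_edges_per_level[OF X] unfolding C_def by (simp only: Suc_le_mono sum_mono)
  also have "\<dots> \<le> 2 * (hi - lo + 4) + 1" using \<open>lo \<le> hi\<close> by auto
  finally show ?thesis .
qed

definition low :: "nat \<Rightarrow> 'v set" where "low r = {v \<in> V. d v < r}"

text \<open>Averaging over the window: the values of \<open>d\<close> at the ends of an edge differ
  by at most 4, so an edge is cut by at most 4 of the sets \<open>low r\<close>.\<close>

lemma ex_small_level_cut:
  assumes "s > 0"
  shows "\<exists>r \<in> {a..<a + s}. s * card (cut (low r)) \<le> 4 * card E"
proof (rule ccontr)
  assume "\<not> ?thesis"
  then have lt: "4 * card E < s * card (cut (low r))" if "r \<in> {a..<a + s}" for r
    using that by (simp add: not_le)
  have "s * (4 * card E) = (\<Sum>r\<in>{a..<a + s}. 4 * card E)" by simp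
  also have "\<dots> < (\<Sum>r\<in>{a..<a + s}. s * card (cut (low r)))"
    using lt assms by (intro sum_strict_mono) auto
  also have "\<dots> = s * (\<Sum>r\<in>{a..<a + s}. card (cut (low r)))" by (simp add: sum_distrib_left)
  also have "(\<Sum>r\<in>{a..<a + s}. card (cut (low r))) =
      (\<Sum>r\<in>{a..<a + s}. \<Sum>e\<in>E. of_bool (e \<in> cut (low r)))"
  proof (rule sum.cong[OF refl])
    fix r
    have "E \<inter> {e. e \<in> cut (low r)} = cut (low r)" by (auto simp: cut_def)
    then show "card (cut (low r)) = (\<Sum>e\<in>E. of_bool (e \<in> cut (low r)))" using fin by simp
  qed
  also have "\<dots> = (\<Sum>e\<in>E. \<Sum>r\<in>{a..<a + s}. of_bool (e \<in> cut (low r)))" by (rule sum.swap)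
  also have "\<dots> \<le> (\<Sum>e\<in>E. 4)"
  proof (rule sum_mono)
    fix e assume e: "e \<in> E"
    have n: "d (h0 e) \<le> d (h1 e) + 4" "d (h1 e) \<le> d (h0 e) + 4"
      using near[OF e, of "h0 e" "f0 e"] near[OF e, of "h1 e" "f0 e"] by auto
    let ?m = "min (d (h0 e)) (d (h1 e))"
    have "(\<Sum>r\<in>{a..<a + s}. of_bool (e \<in> cut (low r))) = card ({a..<a + s} \<inter> {r. e \<in> cut (low r)})"
      by simp
    also have "\<dots> \<le> card {?m<..?m + 4}"
      using e n h[OF e] by (intro card_mono) (auto simp: cut_def low_def)
    finally show "(\<Sum>r\<in>{a..<a + s}. of_bool (e \<in> cut (low r))) \<le> (4::nat)" by simp
  qed
  finally show False by (simp add: mult.commute)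
qed

text \<open>Cheap level cuts are taken just below and just above the median level
  \<open>\<rho>\<close>. If neither is balanced, the slab between them carries more than 4/5 of the
  weight; a fundamental cut splits it, and is short there because the slab is thin.\<close>

theorem balanced_separator:
  assumes W: "W \<subseteq> V" "card W \<ge> 10" and s: "s > 0"
  obtains Z where "Z \<subseteq> V" "card W \<le> 10 * card (W \<inter> Z)" "10 * card (W \<inter> Z) \<le> 9 * card W"
    "s * card (cut Z) \<le> 8 * card E + s * (4 * s + 9)"
proof -
  have fW: "finite W" using W fin finite_subset by blast
  define P where "P r = card (W \<inter> low r)" for r
  have "\<exists>r. \<not> 2 * P r < card W"
  proof (intro exI)
    have "d v < Suc (Max (d ` V))" if "v \<in> V" for v using that fin by (simp add: less_Suc_eq_le)
    then have "low (Suc (Max (d ` V))) = V" by (auto simp: low_def)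
    then have "P (Suc (Max (d ` V))) = card W" using W by (simp add: P_def Int_absorb2)
    then show "\<not> 2 * P (Suc (Max (d ` V))) < card W" by simp
  qed
  moreover have "2 * P 0 < card W" using W by (simp add: P_def low_def)
  ultimately obtain \<rho> where \<rho>: "2 * P \<rho> < card W" "\<not> 2 * P (Suc \<rho>) < card W"
    using nat_induct[of "\<lambda>r. 2 * P r < card W"] by blast
  have mono: "P r \<le> P r'" if "r \<le> r'" for r r'
    unfolding P_def using that fW by (intro card_mono) (auto simp: low_def)
  obtain lo where lo: "lo \<le> \<rho>" "\<rho> \<le> lo + s" "s * card (cut (low lo)) \<le> 4 * card E"
  proof (cases "\<rho> < s")
    case True
    then show ?thesis using that[of 0] by (simp add: low_def)
  next
    case False
    obtain r where "r \<in> {Suc \<rho> - s..<Suc \<rho> - s + s}" "s * card (cut (low r)) \<le> 4 * card E"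
      using ex_small_level_cut[OF s] by blast
    then show ?thesis using that[of r] False by auto
  qed
  obtain hi where hi: "hi \<in> {Suc \<rho>..<Suc \<rho> + s}" "s * card (cut (low hi)) \<le> 4 * card E"
    using ex_small_level_cut[OF s] by blast
  have Plo: "2 * P lo < card W" using mono[of lo \<rho>] lo \<rho> by simp
  have Phi: "2 * P hi \<ge> card W" using mono[of "Suc \<rho>" hi] hi \<rho> by simp
  consider "card W \<le> 10 * P lo" | "10 * P hi \<le> 9 * card W" | "10 * P lo < card W" "9 * card W < 10 * P hi"
    by linarith
  then show ?thesis
  proof cases
    case 1
    then show ?thesis using that[of "low lo"] Plo lo by (simp add: P_def low_def)
  next
    case 2
    then show ?thesis using that[of "low hi"] Phi hi by (simp add: P_def low_def)
  next
    case 3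
    define Y where "Y = {v \<in> V. lo \<le> d v \<and> d v < hi}"
    have lohi: "lo \<le> hi" using lo hi by simp
    have "W \<inter> low hi = (W \<inter> low lo) \<union> (W \<inter> Y)" using lohi by (auto simp: low_def Y_def)
    then have "P hi = P lo + card (W \<inter> Y)"
      unfolding P_def using fW by (subst card_Un_disjoint[symmetric]) (auto simp: low_def Y_def)
    then have w: "10 * card (W \<inter> Y) > 8 * card W" using 3 by linarith
    have w': "card (W \<inter> Y) \<le> card W" using fW by (simp add: card_mono)
    obtain X e where X: "X \<subseteq> V" "cut X \<inter> R = {e}" "card (W \<inter> Y) \<le> 5 * card (W \<inter> Y \<inter> X)"
        "5 * card (W \<inter> Y \<inter> X) \<le> 3 * card (W \<inter> Y) + 2"
      using balanced_fundamental_cut[of "W \<inter> Y"] W w by (auto simp: Y_def)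
    let ?B = "{e' \<in> cut X. h0 e' \<in> Y \<and> h1 e' \<in> Y}"
    have "cut (Y \<inter> X) \<subseteq> cut (low lo) \<union> cut (low hi) \<union> ?B"
      using h by (auto simp: cut_def Y_def low_def)
    then have "card (cut (Y \<inter> X)) \<le> card (cut (low lo) \<union> cut (low hi) \<union> ?B)"
      by (intro card_mono) auto
    also have "\<dots> \<le> card (cut (low lo)) + card (cut (low hi)) + card ?B"
      by (intro order.trans[OF card_Un_le] add_mono card_Un_le order.refl)
    also have "card ?B \<le> 2 * (hi - lo + 4) + 1"
      using card_cut_in_slab[OF X(1,2) lohi Y_def] .
    \<comment> \<open>Both \<open>lo\<close> and \<open>hi\<close> are within \<open>s\<close> of
      \<open>\<rho>\<close>, so the slab has at most \<open>2 * s\<close> levels.\<close>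
    also have "\<dots> \<le> 4 * s + 9" using lo hi by auto
    finally have "s * card (cut (Y \<inter> X)) \<le> s * (card (cut (low lo)) + card (cut (low hi)) + (4 * s + 9))"
      by simp
    also have "\<dots> \<le> 8 * card E + s * (4 * s + 9)" using lo hi by (simp add: add_mult_distrib2)
    finally have c: "s * card (cut (Y \<inter> X)) \<le> 8 * card E + s * (4 * s + 9)" .
    have "Y \<inter> X \<subseteq> V" using X by blast
    \<comment> \<open>A fifth of more than 4/5 of the weight exceeds a tenth. From above, 3/5
      together with the rounding term 2 stays below 9/10 because \<open>card W\<close> is at least
      10.\<close>
    moreover have "card W \<le> 10 * card (W \<inter> (Y \<inter> X))" "10 * card (W \<inter> (Y \<inter> X)) \<le> 9 * card W"
      using X(3,4) w w' W(2) unfolding Int_assoc by linarith+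
    ultimately show ?thesis using that c by blast
  qed
qed

end

section \<open>Breadth-first trees\<close>

lemma breadth_first_tree:
  fixes f0 f1 :: "'e \<Rightarrow> 'f" and E :: "'e set"
  defines "G \<equiv> {(f0 e, f1 e) | e. e \<in> E} \<union> {(f1 e, f0 e) | e. e \<in> E}"
  assumes faces: "\<And>e. e \<in> E \<Longrightarrow> f0 e \<in> F" and conn: "\<And>\<phi>. \<phi> \<in> F \<Longrightarrow> (\<rho>, \<phi>) \<in> G\<^sup>*"
  obtains lev :: "'f \<Rightarrow> nat" and par up where
    "\<And>\<phi>. \<phi> \<in> F \<Longrightarrow> \<phi> \<noteq> \<rho> \<Longrightarrow>
      par \<phi> \<in> E \<and> {f0 (par \<phi>), f1 (par \<phi>)} = {\<phi>, up \<phi>} \<and> lev \<phi> = lev (up \<phi>) + 1"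
    "\<And>e. e \<in> E \<Longrightarrow> lev (f0 e) \<le> lev (f1 e) + 1 \<and> lev (f1 e) \<le> lev (f0 e) + 1"
proof -
  define lev where "lev \<phi> = (LEAST k. (\<rho>, \<phi>) \<in> G ^^ k)" for \<phi>
  have G: "(a, b) \<in> G \<longleftrightarrow> (\<exists>e\<in>E. {f0 e, f1 e} = {a, b})" for a b
    by (auto simp: G_def doubleton_eq_iff)
  have lev_le: "lev \<phi> \<le> k" if "(\<rho>, \<phi>) \<in> G ^^ k" for \<phi> k
    unfolding lev_def using that by (rule Least_le)
  have lev: "(\<rho>, \<phi>) \<in> G ^^ lev \<phi>" if "(\<rho>, \<phi>) \<in> G\<^sup>*" for \<phi>
    unfolding lev_def using rtrancl_imp_relpow[OF that] by (auto intro: LeastI)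
  have step: "lev b \<le> lev a + 1" if "(a, b) \<in> G" "(\<rho>, a) \<in> G\<^sup>*" for a b
    using lev_le[of b "Suc (lev a)"] lev[OF that(2)] that(1) by auto
  \<comment> \<open>A pair packs the parent edge with the face across it, so that one choice fixes
    both consistently.\<close>
  have "\<exists>p. fst p \<in> E \<and> {f0 (fst p), f1 (fst p)} = {\<phi>, snd p} \<and> lev \<phi> = lev (snd p) + 1"
    if \<phi>: "\<phi> \<in> F" "\<phi> \<noteq> \<rho>" for \<phi>
  proof -
    have 1: "(\<rho>, \<phi>) \<in> G ^^ lev \<phi>" by (rule lev[OF conn[OF \<phi>(1)]])
    then obtain k where k: "lev \<phi> = Suc k" using \<phi> by (cases "lev \<phi>") auto
    then obtain \<psi> where \<psi>: "(\<rho>, \<psi>) \<in> G ^^ k" "(\<psi>, \<phi>) \<in> G" using 1 by auto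
    have "lev \<psi> \<le> k" using lev_le \<psi> by blast
    moreover have "lev \<phi> \<le> lev \<psi> + 1" using step[OF \<psi>(2) relpow_imp_rtrancl[OF \<psi>(1)]] .
    ultimately have "lev \<phi> = lev \<psi> + 1" using k by simp
    moreover obtain e where "e \<in> E" "{f0 e, f1 e} = {\<psi>, \<phi>}" using \<psi>(2) G by blast
    ultimately show ?thesis by (intro exI[of _ "(e, \<psi>)"]) (simp add: insert_commute)
  qed
  then obtain p where p: "\<And>\<phi>. \<phi> \<in> F \<Longrightarrow> \<phi> \<noteq> \<rho> \<Longrightarrow> fst (p \<phi>) \<in> E \<and>
      {f0 (fst (p \<phi>)), f1 (fst (p \<phi>))} = {\<phi>, snd (p \<phi>)} \<and> lev \<phi> = lev (snd (p \<phi>)) + 1"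
    by metis
  have "lev (f0 e) \<le> lev (f1 e) + 1 \<and> lev (f1 e) \<le> lev (f0 e) + 1" if e: "e \<in> E" for e
  proof -
    have "(f0 e, f1 e) \<in> G" "(f1 e, f0 e) \<in> G" using e by (auto simp: G_def)
    moreover have "(\<rho>, f0 e) \<in> G\<^sup>*" using conn faces e by blast
    moreover from calculation have "(\<rho>, f1 e) \<in> G\<^sup>*" by (meson rtrancl.rtrancl_into_rtrancl)
    ultimately show ?thesis using step by blast
  qed
  then show ?thesis using that[of "\<lambda>\<phi>. fst (p \<phi>)" "\<lambda>\<phi>. snd (p \<phi>)" lev] p by blast
qed

section \<open>The plane graph of a meander\<close>

locale arch_system =
  fixes N :: nat and mate :: "nat \<Rightarrow> nat"
  assumes mate_less: "a < N \<Longrightarrow> mate a < N"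
    and mate_neq: "a < N \<Longrightarrow> mate a \<noteq> a"
    and mate_mate: "a < N \<Longrightarrow> mate (mate a) = a"
    and mate_noncrossing: "a < N \<Longrightarrow> b < N \<Longrightarrow> a < b \<Longrightarrow> b < mate a \<Longrightarrow> \<not> mate a < mate b"
begin

text \<open>The arcs, named by their left feet, that pass over the interval just before position
  \<open>i\<close>. Two intervals border the same region of the half-plane exactly when these sets
  agree, so the set can serve as a name of the region.\<close>

definition gap :: "nat \<Rightarrow> nat set" where
  "gap i = {a. a < N \<and> a < i \<and> i \<le> mate a}"

lemma gap_0: "gap 0 = {}"
  by (simp add: gap_def)

lemma gap_N: "gap N = {}"
proof -
  have "\<not> N \<le> mate a" if "a < N" for a using mate_less[OF that] by simp
  then show ?thesis by (auto simp: gap_def)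
qed

text \<open>Walking along the line, the arc is entered at its left foot and left at its right foot.
  Noncrossing enters in the last equation: any other arc over one foot is over both.\<close>

lemma gap_arc:
  assumes a: "a < N" "a < mate a"
  shows "gap (Suc a) = insert a (gap a)" "gap (mate a) = insert a (gap (Suc (mate a)))"
    "gap (Suc (mate a)) = gap a"
proof -
  have eq: "x = mate a" if "x < N" "mate x = a" for x using mate_mate[OF that(1)] that by simp
  have eq': "x = a" if "x < N" "mate x = mate a" for x
    using mate_mate[OF that(1)] mate_mate[OF a(1)] that by metis
  show "gap (Suc a) = insert a (gap a)"
    using a eq unfolding gap_def by (auto simp: less_Suc_eq Suc_le_eq le_less)
  have ma: "mate (mate a) = a" by (rule mate_mate[OF a(1)])
  have "x \<in> gap (mate a) \<longleftrightarrow> x = a \<or> x \<in> gap (Suc (mate a))" if x: "x < N" for x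
  proof (cases "x = a \<or> x = mate a")
    case True
    then show ?thesis
    proof
      assume "x = mate a"
      then have "mate x = a" using ma by simp
      then show ?thesis using a \<open>x = mate a\<close> by (simp add: gap_def)
    qed (use a in \<open>simp add: gap_def\<close>)
  next
    case False
    then have "mate x \<noteq> mate a" using eq'[OF x] by blast
    then show ?thesis using False x by (simp add: gap_def Suc_le_eq less_Suc_eq) linarith
  qed
  then show "gap (mate a) = insert a (gap (Suc (mate a)))" using a by (auto simp: gap_def)
  have "x \<in> gap (Suc (mate a)) \<longleftrightarrow> x \<in> gap a" if x: "x < N" for x
  proof
    assume "x \<in> gap (Suc (mate a))"
    then have 1: "x \<le> mate a" "mate a < mate x" by (auto simp: gap_def)
    then have "x \<noteq> mate a" "x \<noteq> a" using ma a by (metis not_less_iff_gr_or_eq)+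
    then have "x < a" using mate_noncrossing[of a x] a x 1 by force
    then show "x \<in> gap a" using x 1 a by (simp add: gap_def)
  next
    assume "x \<in> gap a"
    then have 1: "x < a" "a \<le> mate x" by (auto simp: gap_def)
    then have "mate x \<noteq> a" "mate x \<noteq> mate a" using eq[OF x] eq'[OF x] a by auto
    then have "mate a < mate x" using mate_noncrossing[of x a] a x 1 by force
    then show "x \<in> gap (Suc (mate a))" using x 1 a by (simp add: gap_def)
  qed
  then show "gap (Suc (mate a)) = gap a" by (auto simp: gap_def)
qed

text \<open>This makes the two faces of an arc well defined: they can be read off at either
  foot.\<close>

lemma gap_mate:
  assumes a: "a < N"
  shows "{gap (mate a), gap (Suc (mate a))} = {gap a, gap (Suc a)}"
proof (cases "a < mate a")
  case True
  then show ?thesis using gap_arc[OF a] by auto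
next
  case False
  then have "mate a < mate (mate a)" using mate_neq[OF a] mate_mate[OF a] by simp
  from gap_arc[OF mate_less[OF a] this] show ?thesis unfolding mate_mate[OF a] by auto
qed

lemma gap_neq:
  assumes a: "a < N"
  shows "gap a \<noteq> gap (Suc a)"
proof (cases "a < mate a")
  case True
  then show ?thesis using gap_arc[OF a] by (auto simp: gap_def)
next
  case False
  then have "mate a < mate (mate a)" using mate_neq[OF a] mate_mate[OF a] by simp
  then have "mate a \<in> gap a" "mate a \<notin> gap (Suc a)"
    using mate_less[OF a] mate_mate[OF a] by (simp_all add: gap_def)
  then show ?thesis by blast
qed

text \<open>The \<open>N / 2\<close> arcs give \<open>N / 2\<close> distinct regions, since the
  region just inside the left foot of an arc has that foot as its maximum; the outer region is one
  more.\<close>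

lemma card_gaps: "N + 2 \<le> 2 * card (gap ` {..N})"
proof -
  define L where "L = {a. a < N \<and> a < mate a}"
  have fL: "finite L" by (simp add: L_def)
  have "{..<N} = L \<union> mate ` L"
  proof (intro equalityI subsetI)
    fix a assume "a \<in> {..<N}"
    then have a: "a < N" by simp
    show "a \<in> L \<union> mate ` L"
    proof (cases "a < mate a")
      case False
      then have "mate a \<in> L" using mate_neq[OF a] mate_less[OF a] mate_mate[OF a] a False by (simp add: L_def)
      then show ?thesis using mate_mate[OF a] by (metis UnI2 image_eqI)
    qed (simp add: L_def a)
  qed (auto simp: L_def mate_less)
  then have "N \<le> card L + card (mate ` L)" by (metis card_Un_le card_lessThan)
  then have N: "N \<le> 2 * card L" using card_image_le[OF fL, of mate] by simp
  have max: "Max (gap (Suc a)) = a" if "a \<in> L" for a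
    using that by (intro Max_eqI) (auto simp: gap_def L_def)
  have inj: "inj_on (\<lambda>a. gap (Suc a)) L"
    by (rule inj_on_inverseI) (rule max)
  have "{} \<in> gap ` {..N}" using gap_0 by (metis atMost_iff image_eqI le0)
  moreover have "(\<lambda>a. gap (Suc a)) ` L \<subseteq> gap ` {..N}" by (auto simp: L_def)
  ultimately have "insert {} ((\<lambda>a. gap (Suc a)) ` L) \<subseteq> gap ` {..N}" by simp
  then have "card (insert {} ((\<lambda>a. gap (Suc a)) ` L)) \<le> card (gap ` {..N})"
    by (intro card_mono) auto
  moreover have "{} \<notin> (\<lambda>a. gap (Suc a)) ` L" using gap_arc(1) by (auto simp: L_def)
  ultimately have "Suc (card L) \<le> card (gap ` {..N})" using fL card_image[OF inj] by simp
  then show ?thesis using N by linarith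
qed

end

section \<open>Changes in Boolean words\<close>

fun changes :: "bool list \<Rightarrow> nat" where
  "changes (x # y # xs) = of_bool (x \<noteq> y) + changes (y # xs)"
| "changes _ = 0"

lemma changes_eq_card: "changes xs = card {i. Suc i < length xs \<and> xs ! i \<noteq> xs ! Suc i}"
proof (induction xs rule: changes.induct)
  case (1 x y xs)
  let ?S = "\<lambda>xs. {i. Suc i < length xs \<and> xs ! i \<noteq> xs ! Suc i}"
  have fin: "finite (?S xs)" for xs :: "bool list" by (rule finite_subset[of _ "{..<length xs}"]) auto
  have "?S (x # y # xs) = (if x \<noteq> y then {0} else {}) \<union> Suc ` ?S (y # xs)"
    (is "_ = ?A \<union> ?B")
  proof (intro equalityI subsetI)
    fix i assume "i \<in> ?S (x # y # xs)"
    then show "i \<in> ?A \<union> ?B" by (cases i) auto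
  qed (auto split: if_splits)
  also have "card \<dots> = card ?A + card ?B"
    using fin[of "y # xs"] by (intro card_Un_disjoint finite_imageI) (simp_all split: if_splits)
  also have "card ?B = card (?S (y # xs))" by (rule card_image) simp
  also have "card ?A = of_bool (x \<noteq> y)" by simp
  finally show ?case using "1.IH" by (simp only: changes.simps)
qed simp_all

lemma noncrossing_arch_system:
  assumes "noncrossing M" and "\<And>a. a < N \<Longrightarrow> {a, mate a} \<in> M"
    and "\<And>a. a < N \<Longrightarrow> mate a < N \<and> mate a \<noteq> a \<and> mate (mate a) = a"
  shows "arch_system N mate"
proof
  fix a b assume "a < N" "b < N" "a < b" "b < mate a"
  then show "\<not> mate a < mate b"
    using assms(1) assms(2)[of a] assms(2)[of b] unfolding noncrossing_def by blast
qed (use assms in auto)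

section \<open>Vertices, edges and faces of a meander\<close>

locale meandric_list =
  fixes N :: nat and ts :: "nat list"
  assumes ev: "even N" and pos: "N > 0" and dist: "distinct ts" and set_ts: "set ts = {..<N}"
    and nc: "noncrossing (even_matching ts)" "noncrossing (odd_matching ts)"
begin

lemma length_ts: "length ts = N"
  using distinct_card[OF dist] set_ts by simp

lemma N_ge_2: "N \<ge> 2"
  using ev pos by presburger

definition idx :: "nat \<Rightarrow> nat" where "idx v = (THE i. i < N \<and> ts ! i = v)"

lemma idx: "v < N \<Longrightarrow> idx v < N \<and> ts ! idx v = v"
proof -
  assume "v < N"
  then obtain i where "i < N" "ts ! i = v"
    using set_ts length_ts by (metis in_set_conv_nth lessThan_iff)
  then have "\<exists>!i. i < N \<and> ts ! i = v" using dist length_ts nth_eq_iff_index_eq by blast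
  then show ?thesis unfolding idx_def by (rule theI')
qed

lemma nth_less: "i < N \<Longrightarrow> ts ! i < N"
  using nth_mem[of i ts] unfolding set_ts length_ts by simp

lemma nth_eq_iff: "i < N \<Longrightarrow> j < N \<Longrightarrow> ts ! i = ts ! j \<longleftrightarrow> i = j"
  using nth_eq_iff_index_eq[OF dist] unfolding length_ts by blast

lemma idx_nth:
  assumes "i < N"
  shows "idx (ts ! i) = i"
  using idx[OF nth_less[OF assms]] nth_eq_iff[OF _ assms] by blast

definition nxt :: "nat \<Rightarrow> nat" where "nxt i = (i + 1) mod N"
definition prv :: "nat \<Rightarrow> nat" where "prv i = (if i = 0 then N - 1 else i - 1)"

lemma nxt_eq: "i < N \<Longrightarrow> nxt i = (if i = N - 1 then 0 else Suc i)"
  using pos by (auto simp: nxt_def)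

lemma nxt_prv:
  assumes "i < N"
  shows "nxt i < N" "prv i < N" "nxt (prv i) = i" "prv (nxt i) = i" "nxt i \<noteq> i" "prv i \<noteq> i"
    "even (nxt i) \<longleftrightarrow> odd i" "even (prv i) \<longleftrightarrow> odd i"
proof -
  obtain k where k: "N = 2 * k" using ev by (elim evenE)
  then have "Suc (N - 1) = N" "odd (N - 1)" using pos by simp_all
  then show "nxt i < N" "prv i < N" "nxt (prv i) = i" "prv (nxt i) = i" "nxt i \<noteq> i" "prv i \<noteq> i"
    "even (nxt i) \<longleftrightarrow> odd i" "even (prv i) \<longleftrightarrow> odd i"
    using assms N_ge_2 by (simp_all add: nxt_eq prv_def) auto
qed

lemma nxt_iff: "i < N \<Longrightarrow> j < N \<Longrightarrow> nxt i = j \<longleftrightarrow> i = prv j"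
  using nxt_prv by metis

text \<open>\<open>True\<close> selects \<open>even_matching\<close> and \<open>False\<close>
  selects \<open>odd_matching\<close>. The two are drawn on opposite sides of the line, so the flag
  also names the side.\<close>

definition mate :: "bool \<Rightarrow> nat \<Rightarrow> nat" where
  "mate b v = (let i = idx v in ts ! (if even i = b then nxt i else prv i))"

lemma mate_props:
  assumes v: "v < N"
  shows "mate b v < N \<and> mate b v \<noteq> v \<and> mate b (mate b v) = v"
proof -
  define i j where "i = idx v" and "j = (if even i = b then nxt i else prv i)"
  have i: "i < N" "ts ! i = v" using idx[OF v] by (auto simp: i_def)
  have j: "j < N" "j \<noteq> i" using nxt_prv[OF i(1)] by (auto simp: j_def)
  have "mate b v = ts ! j" by (simp add: mate_def Let_def i_def j_def)
  moreover have "(if even j = b then nxt j else prv j) = i"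
    using nxt_prv[OF i(1)] by (simp add: j_def)
  then have "mate b (ts ! j) = v" using i idx_nth[OF j(1)] by (simp add: mate_def)
  ultimately show ?thesis
    using i j nth_less[OF j(1)] nth_eq_iff[OF j(1) i(1)] by simp
qed

lemma mate_nxt:
  assumes "i < N"
  shows "mate (even i) (ts ! i) = ts ! nxt i"
  using idx_nth[OF assms] by (simp add: mate_def)

lemma pair_in_matching:
  assumes i: "i < N"
  shows "{ts ! i, ts ! nxt i} \<in> (if even i then even_matching ts else odd_matching ts)"
proof (cases "even i")
  case True
  then obtain k where k: "i = 2 * k" by (elim evenE)
  have "2 * k + 1 < N" using i k ev by (auto elim!: evenE)
  moreover from this have "nxt i = 2 * k + 1" using k by (simp add: nxt_def)
  ultimately show ?thesis using True k length_ts by (auto simp: even_matching_def)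
next
  case False
  then obtain k where k: "i = 2 * k + 1" by (elim oddE)
  then show ?thesis using False i length_ts by (auto simp: odd_matching_def nxt_def)
qed

lemma arch_system_mate: "arch_system N (mate b)"
proof (rule noncrossing_arch_system)
  show "noncrossing (if b then even_matching ts else odd_matching ts)" using nc by simp
  fix v assume v: "v < N"
  show "mate b v < N \<and> mate b v \<noteq> v \<and> mate b (mate b v) = v" by (rule mate_props[OF v])
  have i: "idx v < N" "ts ! idx v = v" using idx[OF v] by auto
  show "{v, mate b v} \<in> (if b then even_matching ts else odd_matching ts)"
  proof (cases "even (idx v) = b")
    case True
    then show ?thesis using pair_in_matching[OF i(1)] i by (auto simp: mate_def)
  next
    case False
    have "{ts ! prv (idx v), v} \<in> (if b then even_matching ts else odd_matching ts)"
      using pair_in_matching[of "prv (idx v)"] nxt_prv[OF i(1)] i False by auto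
    then show ?thesis using False by (simp add: mate_def Let_def insert_commute)
  qed
qed

lemmas gap_facts = arch_system.gap_0 arch_system.gap_N arch_system.gap_mate arch_system.gap_neq
  arch_system.card_gaps
lemmas arch_facts = gap_facts[OF arch_system_mate]

text \<open>The plane graph of the meander: \<open>Inl i\<close> is the piece of the line from \<open>i\<close> to \<open>i + 1\<close> and
  \<open>Inr i\<close> the arc from \<open>ts ! i\<close> to \<open>ts ! (i + 1)\<close>; a face is named by its side of the line and the
  set of arcs on that side enclosing it.\<close>

definition E :: "(nat + nat) set" where "E = {..<N} <+> {..<N}"

definition h0 :: "nat + nat \<Rightarrow> nat" where
  "h0 e = (case e of Inl i \<Rightarrow> i | Inr i \<Rightarrow> ts ! i)"
definition h1 :: "nat + nat \<Rightarrow> nat" where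
  "h1 e = (case e of Inl i \<Rightarrow> nxt i | Inr i \<Rightarrow> ts ! nxt i)"

definition fc :: "bool \<Rightarrow> nat \<Rightarrow> bool \<times> nat set" where
  "fc b i = (b, arch_system.gap N (mate b) i)"

definition f0 :: "nat + nat \<Rightarrow> bool \<times> nat set" where
  "f0 e = (case e of Inl i \<Rightarrow> fc True (Suc i) | Inr i \<Rightarrow> fc (even i) (ts ! i))"
definition f1 :: "nat + nat \<Rightarrow> bool \<times> nat set" where
  "f1 e = (case e of Inl i \<Rightarrow> fc False (Suc i) | Inr i \<Rightarrow> fc (even i) (Suc (ts ! i)))"

definition F :: "(bool \<times> nat set) set" where
  "F = fc True ` {..N} \<union> fc False ` {..N}"

lemma fc_neq: "i < N \<Longrightarrow> fc b i \<noteq> fc b (Suc i)"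
  using arch_facts(4) by (simp add: fc_def)

text \<open>The line is closed up through infinity: \<open>Inl (N - 1)\<close> runs from the last
  point back to \<open>0\<close> and separates the two outer faces.\<close>

lemma fc_0_N: "fc b 0 = fc b N"
  by (simp add: fc_def arch_facts(1,2))

lemma fc_mate: "v < N \<Longrightarrow> {fc b (mate b v), fc b (Suc (mate b v))} = {fc b v, fc b (Suc v)}"
  using arch_facts(3)[of v b] by (auto simp: fc_def doubleton_eq_iff)

lemma fc_Suc_prv: "v < N \<Longrightarrow> fc b (Suc (prv v)) = fc b v"
  using pos fc_0_N by (auto simp: prv_def)

lemma faces_of_arc:
  assumes i: "i < N" and v: "v = ts ! i \<or> v = ts ! nxt i"
  shows "{f0 (Inr i), f1 (Inr i)} = {fc (even i) v, fc (even i) (Suc v)}"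
  using v
proof
  assume "v = ts ! nxt i"
  then have "mate (even i) (ts ! i) = v" using mate_nxt[OF i] by simp
  then show ?thesis using fc_mate[OF nth_less[OF i], of "even i"] by (simp add: f0_def f1_def)
qed (simp add: f0_def f1_def)

text \<open>Euler's formula with \<open>N\<close> vertices and \<open>2 * N\<close> edges: each side
  of the line contributes at least \<open>N / 2 + 1\<close> faces, and the flag keeps the sides
  apart.\<close>

lemma F_bounds: "2 * N + 2 \<le> N + card F"
proof -
  have "fc b ` {..N} = Pair b ` (arch_system.gap N (mate b) ` {..N})" for b by (auto simp: fc_def)
  then have "card (fc b ` {..N}) = card (arch_system.gap N (mate b) ` {..N})" for b
    by (simp add: card_image inj_on_def)
  then have "N + 2 \<le> 2 * card (fc b ` {..N})" for b using arch_facts(5)[of b] by simp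
  from this[of True] this[of False] have "N + 2 \<le> card (fc True ` {..N}) + card (fc False ` {..N})"
    by linarith
  also have "\<dots> = card F"
    unfolding F_def by (rule card_Un_disjoint[symmetric]) (auto simp: fc_def)
  finally show ?thesis by simp
qed

sublocale embedded_multigraph E h0 h1 f0 f1 .

lemma E_iff [simp]: "Inl i \<in> E \<longleftrightarrow> i < N" "Inr i \<in> E \<longleftrightarrow> i < N"
  unfolding E_def by auto

lemma finite_E: "finite E" and card_E: "card E = 2 * N"
  by (simp_all add: E_def card_Plus)

lemma fc_in_F: "i \<le> N \<Longrightarrow> fc b i \<in> F"
  by (cases b) (auto simp: F_def)

lemma cut_point:
  assumes v: "v < N"
  shows "cut {v} = {Inl v, Inl (prv v), Inr (idx v), Inr (prv (idx v))}"
proof -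
  have i: "idx v < N" "ts ! idx v = v" using idx[OF v] by auto
  have t: "ts ! j = v \<longleftrightarrow> j = idx v" if "j < N" for j
    using nth_eq_iff[OF that i(1)] i(2) by simp
  have "e \<in> cut {v} \<longleftrightarrow> e \<in> {Inl v, Inl (prv v), Inr (idx v), Inr (prv (idx v))}" for e
  proof (cases e)
    case (Inl j)
    show ?thesis
    proof (cases "j < N")
      case True
      then show ?thesis using Inl nxt_iff[OF True v] nxt_prv(5)[OF True] v nxt_prv(6)[OF v]
        by (auto simp: cut_def h0_def h1_def)
    next
      case False
      then show ?thesis using Inl v nxt_prv(2)[OF v] by (auto simp: cut_def)
    qed
  next
    case (Inr j)
    show ?thesis
    proof (cases "j < N")
      case True
      then show ?thesis
        using Inr t[OF True] t[OF nxt_prv(1)[OF True]] nxt_iff[OF True i(1)] nxt_prv(6)[OF i(1)]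
        by (auto simp: cut_def h0_def h1_def)
    next
      case False
      then show ?thesis using Inr i nxt_prv(2)[OF i(1)] by (auto simp: cut_def)
    qed
  qed
  then show ?thesis by blast
qed

lemma inc_iff:
  assumes "e \<in> E" "{f0 e, f1 e} = {A, B}" "A \<noteq> B"
  shows "e \<in> inc \<phi> \<longleftrightarrow> \<phi> = A \<or> \<phi> = B"
  using assms by (auto simp: inc_def doubleton_eq_iff)

text \<open>Four distinct faces meet at \<open>v\<close>, one per quadrant, and each is bounded
  there by one piece of the line and one arc.\<close>

lemma local_even:
  assumes v: "v < N"
  shows "even (card (cut {v} \<inter> inc \<phi>))"
proof -
  have i: "idx v < N" "ts ! idx v = v" using idx[OF v] by auto
  \<comment> \<open>\<open>p\<close> is the arc at \<open>v\<close> on the \<open>True\<close> side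
    and \<open>q\<close> the one on the other side, whichever of them the curve runs through
    first.\<close>
  obtain p q where pq: "{Inr (idx v), Inr (prv (idx v))} = {Inr p, Inr q :: nat + nat}"
    "even p" "odd q" "p < N" "q < N" "{p, q} = {idx v, prv (idx v)}"
  proof (cases "even (idx v)")
    case True
    then show ?thesis using that[of "idx v" "prv (idx v)"] nxt_prv[OF i(1)] i by auto
  next
    case False
    then show ?thesis using that[of "prv (idx v)" "idx v"] nxt_prv[OF i(1)] i by auto
  qed
  have at: "v = ts ! r \<or> v = ts ! nxt r" if "r \<in> {p, q}" for r
    using that nxt_prv(3)[OF i(1)] i(2) unfolding pq(6) by auto
  define a b c d where "a = fc True v" "b = fc True (Suc v)" "c = fc False v" "d = fc False (Suc v)"
  have ne: "a \<noteq> b" "c \<noteq> d" "a \<noteq> c" "a \<noteq> d" "b \<noteq> c" "b \<noteq> d"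
    using fc_neq[OF v] by (auto simp: a_b_c_d_def fc_def)
  have C: "cut {v} = {Inl v, Inl (prv v), Inr p, Inr q}"
    unfolding cut_point[OF v] pq(1)[symmetric] by auto
  have 1: "Inl v \<in> inc \<phi> \<longleftrightarrow> \<phi> = b \<or> \<phi> = d"
    using v ne by (intro inc_iff) (auto simp: f0_def f1_def a_b_c_d_def)
  have 2: "Inl (prv v) \<in> inc \<phi> \<longleftrightarrow> \<phi> = a \<or> \<phi> = c"
    using nxt_prv(2)[OF v] ne fc_Suc_prv[OF v]
    by (intro inc_iff) (auto simp: f0_def f1_def a_b_c_d_def)
  have 3: "Inr p \<in> inc \<phi> \<longleftrightarrow> \<phi> = a \<or> \<phi> = b"
    using faces_of_arc[OF pq(4), of v] at[of p] ne pq by (intro inc_iff) (auto simp: a_b_c_d_def)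
  have 4: "Inr q \<in> inc \<phi> \<longleftrightarrow> \<phi> = c \<or> \<phi> = d"
    using faces_of_arc[OF pq(5), of v] at[of q] ne pq by (intro inc_iff) (auto simp: a_b_c_d_def)
  have vp: "v \<noteq> prv v" "p \<noteq> q" using nxt_prv(6)[OF v] pq by auto
  consider "\<phi> = a" | "\<phi> = b" | "\<phi> = c" | "\<phi> = d" | "\<phi> \<notin> {a, b, c, d}" by blast
  then show ?thesis
  proof cases
    case 1
    then have "cut {v} \<inter> inc \<phi> = {Inl (prv v), Inr p}" unfolding C using 2 3 4 \<open>Inl v \<in> inc \<phi> \<longleftrightarrow> _\<close> ne by auto
    then show ?thesis by simp
  next
    case 2
    then have "cut {v} \<inter> inc \<phi> = {Inl v, Inr p}" unfolding C using 1 3 4 \<open>Inl (prv v) \<in> inc \<phi> \<longleftrightarrow> _\<close> ne by auto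
    then show ?thesis by simp
  next
    case 3
    then have "cut {v} \<inter> inc \<phi> = {Inl (prv v), Inr q}" unfolding C using 1 2 4 \<open>Inr p \<in> inc \<phi> \<longleftrightarrow> _\<close> ne by auto
    then show ?thesis by simp
  next
    case 4
    then have "cut {v} \<inter> inc \<phi> = {Inl v, Inr q}" unfolding C using 1 2 3 \<open>Inr q \<in> inc \<phi> \<longleftrightarrow> _\<close> ne by auto
    then show ?thesis by simp
  next
    case 5
    then have "cut {v} \<inter> inc \<phi> = {}" unfolding C using 1 2 3 4 by auto
    then show ?thesis by simp
  qed
qed

lemma degree:
  assumes "v < N"
  shows "card (cut {v}) \<le> 4"
  unfolding cut_point[OF assms] by (simp add: card_insert_if)

lemma connected:
  assumes "X \<subseteq> {..<N}" "cut X = {}"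
  shows "X = {} \<or> X = {..<N}"
proof -
  have step: "i \<in> X \<longleftrightarrow> Suc i \<in> X" if "Suc i < N" for i
  proof -
    have "Inl i \<notin> cut X" using assms by simp
    then show ?thesis using that by (simp add: cut_def h0_def h1_def nxt_def)
  qed
  have "i \<in> X \<longleftrightarrow> 0 \<in> X" if "i < N" for i
    using that by (induction i) (use step in auto)
  then show ?thesis using assms(1) by blast
qed

text \<open>Crossing the \<open>True\<close> arc at each point in turn reaches all faces of that
  side; crossing the line reaches the others.\<close>

lemma dual_connected:
  defines "G \<equiv> {(f0 e, f1 e) | e. e \<in> E} \<union> {(f1 e, f0 e) | e. e \<in> E}"
  assumes "\<phi> \<in> F"
  shows "(fc True 0, \<phi>) \<in> G\<^sup>*"
proof -
  have G: "(A, B) \<in> G" if "e \<in> E" "{f0 e, f1 e} = {A, B}" for e A B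
    using that by (auto simp: G_def doubleton_eq_iff)
  have u: "(fc True 0, fc True i) \<in> G\<^sup>*" if "i \<le> N" for i
    using that
  proof (induction i)
    case (Suc i)
    have "(fc True i, fc True (Suc i)) \<in> G"
    proof -
      have i: "i < N" "idx i < N" "ts ! idx i = i" using Suc idx[of i] by auto
      let ?p = "if even (idx i) then idx i else prv (idx i)"
      have p: "?p < N" "even ?p" "i = ts ! ?p \<or> i = ts ! nxt ?p" using i nxt_prv[OF i(2)] by auto
      show ?thesis
        using faces_of_arc[OF p(1,3)] p by (intro G[of "Inr ?p"]) auto
    qed
    then show ?case using Suc by (meson Suc_leD rtrancl.rtrancl_into_rtrancl)
  qed simp
  have l': "(fc True (Suc i), fc False (Suc i)) \<in> G" if "i < N" for i
    using that by (intro G[of "Inl i"]) (auto simp: f0_def f1_def)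
  have l: "(fc True i, fc False i) \<in> G" if "i \<le> N" for i
    using that fc_0_N pos l'[of "i - 1"] l'[of "N - 1"] by (cases i) auto
  show ?thesis using assms(2) u l unfolding F_def
    by (auto intro: rtrancl.rtrancl_into_rtrancl)
qed

lemma ex_levels: "\<exists>lev par up d. levelled_plane_graph E h0 h1 f0 f1 {..<N} F (fc True 0) lev par up d"
proof -
  have F: "f0 e \<in> F" "f1 e \<in> F" if "e \<in> E" for e
    using that nth_less by (cases e; auto simp: f0_def f1_def less_imp_le Suc_le_eq intro!: fc_in_F)+
  obtain lev :: "bool \<times> nat set \<Rightarrow> nat" and par up where
    tree: "\<And>\<phi>. \<phi> \<in> F \<Longrightarrow> \<phi> \<noteq> fc True 0 \<Longrightarrow>
      par \<phi> \<in> E \<and> {f0 (par \<phi>), f1 (par \<phi>)} = {\<phi>, up \<phi>} \<and> lev \<phi> = lev (up \<phi>) + 1"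
    and lip: "\<And>e. e \<in> E \<Longrightarrow> lev (f0 e) \<le> lev (f1 e) + 1 \<and> lev (f1 e) \<le> lev (f0 e) + 1"
    by (rule breadth_first_tree[OF F(1) dual_connected], assumption, assumption, rule that)
  have lip': "lev A \<le> lev B + 1 \<and> lev B \<le> lev A + 1" if "e \<in> E" "{f0 e, f1 e} = {A, B}" for e A B
    using that lip[OF that(1)] by (auto simp: doubleton_eq_iff)
  have side: "lev (fc b v) \<le> lev (fc b (Suc v)) + 1 \<and> lev (fc b (Suc v)) \<le> lev (fc b v) + 1"
    if v: "v < N" for v b
  proof -
    have i: "idx v < N" "ts ! idx v = v" using idx[OF v] by auto
    let ?p = "if even (idx v) = b then idx v else prv (idx v)"
    have p: "?p < N" "even ?p = b" "v = ts ! ?p \<or> v = ts ! nxt ?p" using i nxt_prv[OF i(1)] by auto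
    then show ?thesis using faces_of_arc[OF p(1,3)] by (intro lip'[of "Inr ?p"]) auto
  qed
  have line: "lev (fc True i) \<le> lev (fc False i) + 1 \<and> lev (fc False i) \<le> lev (fc True i) + 1"
    if "i \<le> N" for i
  proof -
    have "lev (fc True (Suc i)) \<le> lev (fc False (Suc i)) + 1 \<and>
        lev (fc False (Suc i)) \<le> lev (fc True (Suc i)) + 1" if "i < N" for i
      using that by (intro lip'[of "Inl i"]) (auto simp: f0_def f1_def)
    from this[of "i - 1"] this[of "N - 1"] show ?thesis
      using that fc_0_N pos by (cases i) auto
  qed
  \<comment> \<open>Any face at \<open>v\<close> is at most two crossings away from this one, one of
    the line and one of an arc; hence the 2 in \<open>near\<close>.\<close>
  define d where "d v = lev (fc True v)" for v
  have near: "lev \<phi> \<le> d v + 2 \<and> d v \<le> lev \<phi> + 2"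
    if e: "e \<in> E" and v: "v \<in> {h0 e, h1 e}" and \<phi>: "\<phi> \<in> {f0 e, f1 e}" for e v \<phi>
  proof (cases e)
    case (Inl i)
    then have i: "i < N" using e by simp
    then have "lev (fc True (nxt i)) = lev (fc True (Suc i))" using fc_0_N[of True] by (auto simp: nxt_eq)
    then show ?thesis using Inl v \<phi> side[OF i, of True] line[of "Suc i"] i
      by (auto simp: h0_def h1_def f0_def f1_def d_def)
  next
    case (Inr i)
    then have i: "i < N" using e by simp
    then have v': "v = ts ! i \<or> v = ts ! nxt i" "v < N"
      using Inr v nth_less nxt_prv(1) by (auto simp: h0_def h1_def)
    then have "\<phi> \<in> {fc (even i) v, fc (even i) (Suc v)}"
      using faces_of_arc[OF i v'(1)] \<phi> Inr by auto
    then show ?thesis using side[OF v'(2), of "even i"] line[of v] v'(2)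
      by (cases "even i") (auto simp: d_def)
  qed
  have "levelled_plane_graph E h0 h1 f0 f1 {..<N} F (fc True 0) lev par up d"
  proof
    show "card E + 2 \<le> card {..<N} + card F" using F_bounds by (simp add: card_E)
    show "{..<N} \<noteq> {}" using pos by auto
    show "fc True 0 \<in> F" by (simp add: F_def)
  next
    fix e assume "e \<in> E"
    then show "h0 e \<in> {..<N}" "h1 e \<in> {..<N}"
      using nth_less nxt_prv(1) by (cases e; simp add: h0_def h1_def)+
  qed (use pos local_even connected degree tree near finite_E in \<open>simp_all add: F_def\<close>)
  then show ?thesis by blast
qed

theorem separator:
  assumes "W \<subseteq> {..<N}" "card W \<ge> 10" "s > 0"
  obtains Z where "card W \<le> 10 * card (W \<inter> Z)" "10 * card (W \<inter> Z) \<le> 9 * card W"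
    "s * changes (map (\<lambda>x. x \<in> Z) [0..<N]) \<le> 16 * N + s * (4 * s + 9)"
    "s * changes (map (\<lambda>x. x \<in> Z) ts) \<le> 16 * N + s * (4 * s + 9)"
proof -
  obtain lev par up d where
    "levelled_plane_graph E h0 h1 f0 f1 {..<N} F (fc True 0) lev par up d"
    using ex_levels by blast
  then interpret levelled_plane_graph E h0 h1 f0 f1 "{..<N}" F "fc True 0" lev par up d .
  obtain Z where Z: "Z \<subseteq> {..<N}" "card W \<le> 10 * card (W \<inter> Z)" "10 * card (W \<inter> Z) \<le> 9 * card W"
    "s * card (cut Z) \<le> 8 * card E + s * (4 * s + 9)"
    using balanced_separator[OF assms] by blast
  have fE: "finite (cut Z)" using finite_E by (simp add: cut_def)
  \<comment> \<open>Each change is an edge of the cut. The closing edges of the line and of the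
    curve are not counted by \<open>changes\<close>.\<close>
  have "changes (map (\<lambda>x. x \<in> Z) [0..<N]) \<le> card (cut Z)"
    unfolding changes_eq_card using fE
    by (intro card_inj_on_le[where f = Inl]) (auto simp: cut_def h0_def h1_def nxt_def)
  then have 1: "s * changes (map (\<lambda>x. x \<in> Z) [0..<N]) \<le> s * card (cut Z)" by simp
  have "changes (map (\<lambda>x. x \<in> Z) ts) = card {i. Suc i < N \<and> (ts ! i \<in> Z) \<noteq> (ts ! Suc i \<in> Z)}"
    unfolding changes_eq_card length_map length_ts
    by (intro arg_cong[where f = card] Collect_cong conj_cong refl) (simp add: length_ts)
  also have "\<dots> \<le> card (cut Z)"
    using fE
    by (intro card_inj_on_le[where f = Inr]) (auto simp: cut_def h0_def h1_def nxt_def)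
  finally have 2: "s * changes (map (\<lambda>x. x \<in> Z) ts) \<le> s * card (cut Z)" by simp
  have "8 * card E = 16 * N" using card_E by simp
  then show ?thesis using that[OF Z(2,3)] order.trans[OF 1 Z(4)] order.trans[OF 2 Z(4)] by simp
qed

end

section \<open>Expanding lists\<close>

lemma finite_length_bool: "finite {w :: bool list. length w = m}"
  using finite_lists_length_eq[of "UNIV :: bool set" m] by simp

text \<open>Each letter either repeats its predecessor, with weight 1, or differs from it, with
  weight \<open>x\<close>.\<close>

lemma sum_power_changes:
  fixes x :: real
  shows "(\<Sum>w | length w = m. x ^ changes (b # w)) = (1 + x) ^ m"
proof (induction m arbitrary: b)
  case (Suc m)
  let ?A = "{w :: bool list. length w = m}"
  have "{w :: bool list. length w = Suc m} = (#) b ` ?A \<union> (#) (\<not> b) ` ?A"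
    by (auto simp: length_Suc_conv image_iff)
  then have "(\<Sum>w | length w = Suc m. x ^ changes (b # w)) =
      (\<Sum>w\<in>(#) b ` ?A. x ^ changes (b # w)) + (\<Sum>w\<in>(#) (\<not> b) ` ?A. x ^ changes (b # w))"
    using finite_length_bool by (simp only:) (rule sum.union_disjoint, auto)
  also have "(\<Sum>w\<in>(#) b ` ?A. x ^ changes (b # w)) = (1 + x) ^ m"
    by (subst sum.reindex) (simp_all add: Suc.IH)
  also have "(\<Sum>w\<in>(#) (\<not> b) ` ?A. x ^ changes (b # w)) = x * (1 + x) ^ m"
    by (subst sum.reindex) (simp_all add: sum_distrib_left[symmetric] Suc.IH)
  finally show ?case by (simp add: algebra_simps)
qed simp

definition few_changes :: "nat \<Rightarrow> nat \<Rightarrow> bool list set" where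
  "few_changes m j = {w. length w = m \<and> changes w \<le> j}"

lemma finite_few_changes: "finite (few_changes m j)"
  using finite_length_bool[of m] unfolding few_changes_def by (rule rev_finite_subset) auto

text \<open>Markov's inequality for the generating function: as \<open>x \<le> 1\<close>, every
  counted word weighs at least \<open>x ^ j\<close>. The factor 2 is the free first letter.\<close>

lemma card_few_changes:
  fixes x :: real
  assumes "0 < x" "x \<le> 1" "m > 0"
  shows "card (few_changes m j) * x ^ j \<le> 2 * (1 + x) ^ m"
proof -
  obtain k where k: "m = Suc k" using \<open>m > 0\<close> by (cases m) auto
  let ?A = "{w :: bool list. length w = k}"
  have split: "{w :: bool list. length w = m} = (#) True ` ?A \<union> (#) False ` ?A"
    unfolding k by (auto simp: length_Suc_conv image_iff)
  have "card (few_changes m j) * x ^ j = (\<Sum>w\<in>few_changes m j. x ^ j)" by simp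
  also have "\<dots> \<le> (\<Sum>w\<in>few_changes m j. x ^ changes w)"
    using assms by (intro sum_mono power_decreasing) (auto simp: few_changes_def)
  also have "\<dots> \<le> (\<Sum>w | length w = m. x ^ changes w)"
    using finite_length_bool assms by (intro sum_mono2) (auto simp: few_changes_def)
  also have "\<dots> = (\<Sum>w\<in>(#) True ` ?A. x ^ changes w) + (\<Sum>w\<in>(#) False ` ?A. x ^ changes w)"
    unfolding split using finite_length_bool by (intro sum.union_disjoint) auto
  also have "\<dots> = 2 * (1 + x) ^ k"
    by (simp add: sum.reindex sum_power_changes)
  also have "\<dots> \<le> 2 * (1 + x) ^ m" using assms k by (intro mult_left_mono power_increasing) auto
  finally show ?thesis .
qed

text \<open>Below the middle, \<open>(n / b) ^ b\<close> is at least \<open>2 ^ b\<close>; above it,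
  symmetry applies.\<close>

lemma power2_le_binomial:
  assumes "K \<le> a" "K \<le> n - a" "a \<le> n"
  shows "2 ^ K \<le> real (n choose a)"
proof -
  have *: "2 ^ K \<le> real (n choose b)" if "K \<le> b" "2 * b \<le> n" for b
  proof (cases "b = 0")
    case False
    have "(2::real) ^ K \<le> 2 ^ b" using that by (intro power_increasing) auto
    also have "\<dots> \<le> (real n / real b) ^ b"
      using that False by (intro power_mono) (simp_all add: field_simps)
    also have "\<dots> \<le> real (n choose b)" using that by (intro binomial_ge_n_over_k_pow_k) auto
    finally show ?thesis .
  qed (use that in simp)
  show ?thesis
  proof (cases "2 * a \<le> n")
    case True
    then show ?thesis using * assms by blast
  next
    case False
    then show ?thesis using *[of "n - a"] assms binomial_symmetric[of a n] by simp
  qed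
qed

section \<open>Random orders of balanced sets\<close>

lemma map_filter_inject:
  assumes "map P xs = map P ys" "filter P xs = filter P ys"
    "filter (\<lambda>x. \<not> P x) xs = filter (\<lambda>x. \<not> P x) ys"
  shows "xs = ys"
  using assms
proof (induction xs arbitrary: ys)
  case (Cons x xs)
  then obtain y zs where "ys = y # zs" "P x = P y" "map P xs = map P zs" by auto
  then show ?case using Cons by (cases "P x") auto
qed simp

text \<open>A list is recovered from its pattern and the orders inside and outside \<open>A\<close>.
  So a given pattern has probability at most \<open>1 / (card S choose card A)\<close> in a random
  order.\<close>

lemma card_perms_with_pattern:
  assumes "finite S" "A \<subseteq> S"
  shows "card {es \<in> permutations_of_set S. map (\<lambda>x. x \<in> A) es = w} \<le> fact (card A) * fact (card S - card A)"
proof -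
  have fA: "finite A" using assms finite_subset by blast
  let ?f = "\<lambda>es. (filter (\<lambda>x. x \<in> A) es, filter (\<lambda>x. x \<notin> A) es)"
  let ?B = "permutations_of_set A \<times> permutations_of_set (S - A)"
  have "card {es \<in> permutations_of_set S. map (\<lambda>x. x \<in> A) es = w} \<le> card ?B"
  proof (rule card_inj_on_le[where f = ?f])
    show "inj_on ?f {es \<in> permutations_of_set S. map (\<lambda>x. x \<in> A) es = w}"
      using map_filter_inject[where P = "\<lambda>x. x \<in> A"] by (auto intro!: inj_onI)
    show "?f ` {es \<in> permutations_of_set S. map (\<lambda>x. x \<in> A) es = w} \<subseteq> ?B"
      using assms by (auto simp: permutations_of_set_def)
  qed (use assms fA in auto)
  also have "card ?B = fact (card A) * fact (card S - card A)"
    using assms fA by (simp add: card_cartesian_product card_Diff_subset)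
  finally show ?thesis .
qed

text \<open>The fractions 1/10 and 9/10 are those delivered by
  \<open>balanced_separator\<close>.\<close>

definition balanced :: "nat \<Rightarrow> nat set \<Rightarrow> bool" where
  "balanced m A \<longleftrightarrow> A \<subseteq> {..<m} \<and> m \<le> 10 * card A \<and> 10 * card A \<le> 9 * m"

definition expanding :: "nat \<Rightarrow> nat list \<Rightarrow> bool" where
  "expanding m es \<longleftrightarrow> (\<forall>A. balanced m A \<longrightarrow>
     m div 300 < changes (map (\<lambda>x. x \<in> A) [0..<m]) \<or> m div 300 < changes (map (\<lambda>x. x \<in> A) es))"

text \<open>With \<open>x = 1 / 64\<close> the base 2 logarithm of the left side is at most
  \<open>2 + m * (1 / 22 + 1 / 25)\<close>. The coefficient of \<open>m\<close> is below 1/10, which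
  explains the 300 in \<open>expanding\<close>, and \<open>m \<ge> 200\<close> absorbs the
  2.\<close>

lemma few_changes_square:
  assumes "m \<ge> 200"
  shows "real (card (few_changes m (m div 300))) ^ 2 < 2 ^ ((m + 9) div 10)"
proof -
  let ?q = "real (card (few_changes m (m div 300)))" and ?j = "m div 300" and ?K = "(m + 9) div 10"
  have "?q * (1 / 64) ^ ?j \<le> 2 * (1 + 1 / 64) ^ m" using assms by (intro card_few_changes) auto
  then have "?q \<le> 2 * (1 + 1 / 64) ^ m * 64 ^ ?j" by (simp add: power_divide field_simps)
  then have "?q ^ 2 \<le> (2 * (1 + 1 / 64) ^ m * 64 ^ ?j) ^ 2" by (intro power_mono) auto
  also have "\<dots> < 2 ^ ?K"
  proof -
    have "44 * ln (1 + 1 / 64 :: real) = ln ((1 + 1 / 64) ^ 44)" by (simp add: ln_realpow)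
    also have "\<dots> \<le> ln 2" by (subst ln_le_cancel_iff) (simp_all add: field_simps)
    finally have l: "ln (1 + 1 / 64 :: real) \<le> ln 2 / 44" by simp
    have l64: "ln (64::real) = 6 * ln 2" using ln_realpow[of 2 6] by simp
    have j: "real ?j \<le> real m / 300" by linarith
    have K: "real ?K \<ge> real m / 10" by linarith
    have "ln ((2 * (1 + 1 / 64) ^ m * 64 ^ ?j) ^ 2 :: real) =
        2 * ln 2 + 2 * real m * ln (1 + 1 / 64) + 12 * real ?j * ln 2"
      using ln_realpow[of 2 2] by (simp add: ln_mult ln_realpow l64 algebra_simps)
    also have "\<dots> \<le> 2 * ln 2 + 2 * real m * (ln 2 / 44) + 12 * (real m / 300) * ln 2"
      using l j by (intro add_mono mult_left_mono mult_right_mono) auto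
    also have "\<dots> = (2 + real m * (1 / 22 + 1 / 25)) * ln 2" by (simp add: algebra_simps)
    also have "\<dots> < real ?K * ln 2" using K assms by (intro mult_strict_right_mono) auto
    also have "\<dots> = ln (2 ^ ?K)" by (simp add: ln_realpow)
    finally show ?thesis by (subst (asm) ln_less_cancel_iff) auto
  qed
  finally show ?thesis .
qed

text \<open>Union bound: with \<open>q\<close> words of few changes there are at most
  \<open>q\<close> dangerous sets \<open>A\<close>, and each is bad for at most a fraction
  \<open>q / 2 ^ K\<close> of all orders; \<open>few_changes_square\<close> makes the product less
  than 1.\<close>

theorem ex_expanding:
  assumes m: "m \<ge> 200"
  shows "\<exists>es. distinct es \<and> set es = {..<m} \<and> expanding m es"
proof (rule ccontr)
  assume no: "\<not> ?thesis"
  define j K q where "j = m div 300" and "K = (m + 9) div 10" and "q = card (few_changes m j)"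
  define As where "As = {A. balanced m A \<and> changes (map (\<lambda>x. x \<in> A) [0..<m]) \<le> j}"
  define Bad where "Bad A = {es \<in> permutations_of_set {..<m}. changes (map (\<lambda>x. x \<in> A) es) \<le> j}" for A
  have fAs: "finite As" by (rule finite_subset[of _ "Pow {..<m}"]) (auto simp: As_def balanced_def)
  have "card As \<le> q"
    unfolding q_def
  proof (rule card_inj_on_le[where f = "\<lambda>A. map (\<lambda>x. x \<in> A) [0..<m]"])
    show "inj_on (\<lambda>A. map (\<lambda>x. x \<in> A) [0..<m]) As"
      by (rule inj_onI) (auto simp: As_def balanced_def)
    show "finite (few_changes m j)" by (rule finite_few_changes)
  qed (auto simp: As_def few_changes_def)
  have bad: "real (card (Bad A)) \<le> q * (fact m / 2 ^ K)" if A: "A \<in> As" for A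
  proof -
    define a where "a = card A"
    have A': "A \<subseteq> {..<m}" "m \<le> 10 * a" "10 * a \<le> 9 * m"
      using A by (auto simp: As_def balanced_def a_def)
    have "Bad A \<subseteq> (\<Union>w\<in>few_changes m j. {es \<in> permutations_of_set {..<m}. map (\<lambda>x. x \<in> A) es = w})"
      using length_finite_permutations_of_set[of _ "{..<m}"] by (auto simp: Bad_def few_changes_def)
    then have "card (Bad A) \<le>
        card (\<Union>w\<in>few_changes m j. {es \<in> permutations_of_set {..<m}. map (\<lambda>x. x \<in> A) es = w})"
      using finite_few_changes by (intro card_mono) auto
    also have "\<dots> \<le> (\<Sum>w\<in>few_changes m j. card {es \<in> permutations_of_set {..<m}. map (\<lambda>x. x \<in> A) es = w})"
      by (rule card_UN_le[OF finite_few_changes])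
    also have "\<dots> \<le> (\<Sum>w\<in>few_changes m j. fact a * fact (m - a))"
      using card_perms_with_pattern[of "{..<m}" A] A' by (intro sum_mono) (simp add: a_def)
    also have "\<dots> = q * (fact a * fact (m - a))" by (simp add: q_def)
    finally have "real (card (Bad A)) \<le> real (q * (fact a * fact (m - a)))" by (rule of_nat_mono)
    also have "\<dots> = real q * (fact a * fact (m - a))" by simp
    also have "(fact a * fact (m - a) :: real) \<le> fact m / 2 ^ K"
    proof -
      have "2 ^ K \<le> real (m choose a)"
        using A' m by (intro power2_le_binomial) (auto simp: K_def)
      then have "fact a * fact (m - a) * 2 ^ K \<le> (fact a * fact (m - a) * real (m choose a) :: real)"
        by (intro mult_left_mono) auto
      also have "\<dots> = fact m"
        using arg_cong[OF binomial_fact_lemma[of a m], of "of_nat :: nat \<Rightarrow> real"] A' by simp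
      finally show ?thesis by (simp add: field_simps)
    qed
    finally show ?thesis by (simp add: mult_left_mono)
  qed
  have "permutations_of_set {..<m} \<subseteq> (\<Union>A\<in>As. Bad A)"
  proof
    fix es assume es: "es \<in> permutations_of_set {..<m}"
    then have "\<not> expanding m es" using no by (auto simp: permutations_of_set_def)
    then show "es \<in> (\<Union>A\<in>As. Bad A)" using es
      by (auto simp: expanding_def As_def Bad_def j_def not_less)
  qed
  then have "card (permutations_of_set {..<m}) \<le> card (\<Union>A\<in>As. Bad A)"
    using fAs by (intro card_mono) (auto simp: Bad_def)
  also have "\<dots> \<le> (\<Sum>A\<in>As. card (Bad A))" by (rule card_UN_le[OF fAs])
  finally have "real (fact m) \<le> real (\<Sum>A\<in>As. card (Bad A))" by (intro of_nat_mono) simp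
  then have "(fact m :: real) \<le> (\<Sum>A\<in>As. real (card (Bad A)))" by simp
  also have "\<dots> \<le> (\<Sum>A\<in>As. q * (fact m / 2 ^ K))" by (intro sum_mono bad)
  also have "\<dots> = real (card As) * (q * (fact m / 2 ^ K))" by simp
  also have "\<dots> \<le> q * (q * (fact m / 2 ^ K))" using \<open>card As \<le> q\<close> by (intro mult_right_mono) auto
  also have "\<dots> = real q ^ 2 / 2 ^ K * fact m" by (simp add: power2_eq_square)
  also have "\<dots> < 1 * fact m"
    using few_changes_square[OF m] by (intro mult_strict_right_mono) (auto simp: q_def j_def K_def)
  finally show False by simp
qed

section \<open>Grid meanders\<close>

text \<open>Blocks are convex because \<open>blk\<close> is monotone, and arcs within a block are
  concentric because their end points have the same sum. The closing arc \<open>{0, X}\<close> is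
  harmless, as no rainbow arc has an end to the left of \<open>X\<close>.\<close>

lemma noncrossing_if_rainbows:
  fixes blk tot :: "nat \<Rightarrow> nat"
  assumes "mono blk"
    and pairs: "\<And>P. P \<in> M \<Longrightarrow> (\<exists>a. P = {a, Suc a}) \<or> P = {0, X} \<or>
      (\<exists>p q. P = {p, q} \<and> X \<le> p \<and> X \<le> q \<and> blk p = blk q \<and> p + q = tot (blk p))"
  shows "noncrossing M"
  unfolding noncrossing_def
proof (intro notI, elim exE conjE)
  fix a b c d :: nat
  assume P: "{a, b} \<in> M" "{c, d} \<in> M" and less: "a < c" "c < b" "b < d"
  have 1: "(a = 0 \<and> b = X) \<or> (X \<le> a \<and> blk a = blk b \<and> a + b = tot (blk a))"
    using pairs[OF P(1)] less by (auto simp: doubleton_eq_iff add.commute)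
  have 2: "X \<le> c \<and> blk c = blk d \<and> c + d = tot (blk c)"
    using pairs[OF P(2)] less by (auto simp: doubleton_eq_iff add.commute)
  have 3: "X \<le> a \<and> blk a = blk b \<and> a + b = tot (blk a)" using 1 2 less by auto
  have "blk a \<le> blk c" "blk c \<le> blk b" using \<open>mono blk\<close> less by (auto simp: monoD)
  then have "blk c = blk a" using 3 by simp
  then have "tot (blk c) = tot (blk a)" by simp
  then show False using 2 3 less by linarith
qed

lemma filter_upt_image:
  assumes "strict_mono_on {..<m} f" "\<And>i. i < m \<Longrightarrow> f i < n"
  shows "filter (\<lambda>j. j \<in> f ` {..<m}) [0..<n] = map f [0..<m]"
proof (rule sorted_distinct_set_unique)
  show "sorted (map f [0..<m])"
    using assms(1) by (auto simp: sorted_iff_nth_mono_less strict_mono_on_def less_imp_le)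
  show "distinct (map f [0..<m])"
    using strict_mono_on_imp_inj_on[OF assms(1)] by (simp add: distinct_map atLeast0LessThan)
  show "set (filter (\<lambda>j. j \<in> f ` {..<m}) [0..<n]) = set (map f [0..<m])" using assms(2) by auto
qed (auto intro: sorted_wrt_filter)

lemma relabel_image:
  assumes "strict_mono_on {..<n} q" "i < n"
  shows "relabel (q ` {..<n}) (q i) = i"
proof -
  have "q j < q i \<longleftrightarrow> j < i" if "j < n" for j
    using assms that strict_mono_on_less[OF assms(1)] by simp
  then have "{y \<in> q ` {..<n}. y < q i} = q ` {..<i}" using assms(2) by auto
  moreover have "inj_on q {..<i}"
    using strict_mono_on_imp_inj_on[OF assms(1)] assms(2) by (auto elim: inj_on_subset)
  ultimately show ?thesis by (simp add: relabel_def card_image)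
qed

text \<open>Draw the line as \<open>M\<close> vertical strands of a grid, traversed alternately upwards and downwards,
  and the closed curve as its \<open>M\<close> horizontal strands, traversed alternately rightwards and leftwards.
  Then \<open>column_pos x y\<close> is the position on the line of the crossing of column \<open>x\<close> with row \<open>y\<close>. The
  first crossing is preceded by \<open>K\<close> further ones.\<close>

locale grid_meander =
  fixes M K :: nat
  assumes even_M: "even M" and M_pos: "M > 0" and even_K: "even K"
begin

definition snake :: "nat \<Rightarrow> nat \<Rightarrow> nat" where
  "snake y t = (if even y then t else M - 1 - t)"

definition column_pos :: "nat \<Rightarrow> nat \<Rightarrow> nat" where
  "column_pos x y = x * M + snake x y"

definition crossing :: "nat \<Rightarrow> nat" where
  "crossing j = K + column_pos (snake (j div M) (j mod M)) (j div M)"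

definition N :: nat where "N = K + M * M"

definition ts :: "nat list" where
  "ts = [0..<K] @ map crossing [0..<M * M]"

lemma length_ts: "length ts = N"
  by (simp add: ts_def N_def)

lemma snake_less: "t < M \<Longrightarrow> snake y t < M"
  by (auto simp: snake_def)

lemma snake_snake: "t < M \<Longrightarrow> snake y (snake y t) = t"
  by (auto simp: snake_def)

lemma column_pos_less: "y < M \<Longrightarrow> column_pos x y < Suc x * M"
  using snake_less[of y x] by (simp add: column_pos_def)

lemma column_pos_inject:
  assumes "y < M" "y' < M" "column_pos x y = column_pos x' y'"
  shows "x = x' \<and> y = y'"
proof -
  have s: "snake x y < M" "snake x' y' < M" using snake_less assms by auto
  have "x = column_pos x y div M" "x' = column_pos x' y' div M"
    using s M_pos by (auto simp: column_pos_def)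
  then have x: "x = x'" using assms by simp
  then have "snake x y = snake x y'" using assms by (simp add: column_pos_def)
  then show ?thesis using x snake_snake assms by metis
qed

lemma row_less: "j < M * M \<Longrightarrow> j div M < M"
  by (simp add: less_mult_imp_div_less)

lemma crossing_bounds: "j < M * M \<Longrightarrow> K \<le> crossing j \<and> crossing j < N"
proof -
  assume j: "j < M * M"
  have "snake (j div M) (j mod M) < M" using M_pos by (simp add: snake_less)
  then have "Suc (snake (j div M) (j mod M)) * M \<le> M * M" by (intro mult_right_mono) auto
  then show ?thesis using column_pos_less[OF row_less[OF j], of "snake (j div M) (j mod M)"]
    by (simp add: crossing_def N_def)
qed

lemma crossing_inject:
  assumes "i < M * M" "j < M * M" "crossing i = crossing j"
  shows "i = j"
proof -
  have eq: "snake (i div M) (i mod M) = snake (j div M) (j mod M)" "i div M = j div M"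
    using column_pos_inject[OF row_less[OF assms(1)] row_less[OF assms(2)]] assms(3)
    by (auto simp: crossing_def)
  then have "snake (i div M) (i mod M) = snake (i div M) (j mod M)" by simp
  then have "i mod M = j mod M" using M_pos snake_snake by (metis mod_less_divisor)
  then show ?thesis using eq(2) by (metis div_mult_mod_eq)
qed

lemma distinct_ts: "distinct ts"
proof -
  have "inj_on crossing {..<M * M}" by (rule inj_onI) (simp add: crossing_inject)
  moreover have "set [0..<K] \<inter> crossing ` {..<M * M} = {}" using crossing_bounds by fastforce
  ultimately show ?thesis by (simp add: ts_def distinct_map atLeast0LessThan)
qed

lemma set_ts: "set ts = {..<N}"
proof (rule card_subset_eq)
  show "set ts \<subseteq> {..<N}" using crossing_bounds by (auto simp: ts_def N_def)
  show "card (set ts) = card {..<N}" using distinct_card[OF distinct_ts] length_ts by simp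
qed simp

lemma ts_nth_less: "i < K \<Longrightarrow> ts ! i = i"
  by (simp add: ts_def nth_append)

lemma ts_nth_add: "j < M * M \<Longrightarrow> ts ! (K + j) = crossing j"
  by (simp add: ts_def nth_append)

lemma crossing_0: "crossing 0 = K"
  by (simp add: crossing_def column_pos_def snake_def)

lemma crossing_eq: "t < M \<Longrightarrow> crossing (y * M + t) = K + column_pos (snake y t) y"
  by (simp add: crossing_def)

lemma column_pair:
  assumes "y < M" "Suc x < M"
  shows "column_pos x y + column_pos (Suc x) y + 1 = 2 * Suc x * M"
    and "x * M \<le> column_pos x y" "column_pos x y < (x + 2) * M"
    and "x * M \<le> column_pos (Suc x) y" "column_pos (Suc x) y < (x + 2) * M"
proof -
  have "snake x y + snake (Suc x) y + 1 = M" using assms by (simp add: snake_def)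
  then show "column_pos x y + column_pos (Suc x) y + 1 = 2 * Suc x * M"
    and "x * M \<le> column_pos x y" "column_pos x y < (x + 2) * M"
    and "x * M \<le> column_pos (Suc x) y" "column_pos (Suc x) y < (x + 2) * M"
    unfolding column_pos_def by (simp_all add: distrib_right)
qed

text \<open>Here \<open>x\<close> is the left one of the two columns, in whichever direction the row
  runs. That \<open>M\<close> is even keeps its parity equal to that of the step.\<close>

lemma row_step:
  assumes "y < M" "Suc t < M"
  obtains x where "Suc x < M" "even x \<longleftrightarrow> even t"
    "{crossing (y * M + t), crossing (y * M + Suc t)} = {K + column_pos x y, K + column_pos (Suc x) y}"
proof (cases "even y")
  case True
  then show ?thesis using that[of t] assms crossing_eq[of t y] crossing_eq[of "Suc t" y]
    by (simp add: snake_def)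
next
  case False
  define x where "x = M - 2 - t"
  have x: "M = x + t + 2" using assms by (simp add: x_def)
  then have "snake y t = Suc x" "snake y (Suc t) = x" unfolding snake_def using False x by simp_all
  moreover have "even x \<longleftrightarrow> even t" using even_M unfolding x by simp
  moreover have "Suc x < M" using x by simp
  ultimately show ?thesis using that[of x] assms crossing_eq[of t y] crossing_eq[of "Suc t" y]
    by (simp add: insert_commute)
qed

text \<open>Inside a row these steps join columns \<open>2 * a\<close> and \<open>2 * a + 1\<close>.
  The line runs through these one after the other in opposite directions, so the arcs of all rows
  are concentric about the turn between them.\<close>

lemma noncrossing_even: "noncrossing (even_matching ts)"
proof (rule noncrossing_if_rainbows[where X = 0 and blk = "\<lambda>v. (v - K) div (2 * M)"
      and tot = "\<lambda>a. 2 * K + (4 * a + 2) * M - 1"])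
  show "mono (\<lambda>v. (v - K) div (2 * M))" by (intro monoI div_le_mono diff_le_mono)
  fix P assume "P \<in> even_matching ts"
  then obtain i where i: "Suc (2 * i) < N" "P = {ts ! (2 * i), ts ! Suc (2 * i)}"
    by (auto simp: even_matching_def length_ts)
  show "(\<exists>a. P = {a, Suc a}) \<or> P = {0, 0} \<or> (\<exists>p q. P = {p, q} \<and> 0 \<le> p \<and> 0 \<le> q \<and>
      (p - K) div (2 * M) = (q - K) div (2 * M) \<and>
      p + q = 2 * K + (4 * ((p - K) div (2 * M)) + 2) * M - 1)"
  proof (cases "2 * i < K")
    case True
    then have "Suc (2 * i) < K" using even_K by presburger
    then show ?thesis using i ts_nth_less by auto
  next
    case False
    define j where "j = 2 * i - K"
    have j: "2 * i = K + j" "even j" "Suc j < M * M"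
      using False i even_K by (auto simp: j_def N_def)
    define y t where "y = j div M" and "t = j mod M"
    have jy: "j = y * M + t" by (simp add: y_def t_def)
    \<comment> \<open>As \<open>M\<close> is even, a step has the same parity within its row as
      along the whole curve.\<close>
    have "t < M" "even t" using M_pos even_M j(2) by (auto simp: t_def even_M dvd_mod)
    then have t: "Suc t < M" using even_M by presburger
    have y: "y < M" using j(3) by (simp add: y_def row_less)
    obtain x where x: "Suc x < M" "even x"
      "{crossing (y * M + t), crossing (y * M + Suc t)} = {K + column_pos x y, K + column_pos (Suc x) y}"
      using row_step[OF y t] \<open>even t\<close> by blast
    have P: "P = {K + column_pos x y, K + column_pos (Suc x) y}"
      using i(2) x(3) ts_nth_add[of j] ts_nth_add[of "Suc j"] j unfolding jy by simp
    obtain a where a: "x = 2 * a" using x(2) by (elim evenE)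
    note c = column_pair[OF y x(1)]
    have "column_pos x y div (2 * M) = a" "column_pos (Suc x) y div (2 * M) = a"
      using c(2-) M_pos unfolding a by (auto intro!: div_nat_eqI simp: algebra_simps)
    moreover have "column_pos x y + column_pos (Suc x) y + 1 = (4 * a + 2) * M"
      using c(1) by (simp add: a algebra_simps)
    ultimately show ?thesis
      by (intro disjI2 exI[of _ "K + column_pos x y"] exI[of _ "K + column_pos (Suc x) y"] conjI P) auto
  qed
qed

text \<open>Now columns \<open>2 * a + 1\<close> and \<open>2 * a + 2\<close> are joined, so the
  blocks are shifted by \<open>M\<close>. Steps from row to row, and those among the first
  \<open>K\<close> crossings, join neighbours on the line.\<close>

lemma noncrossing_odd: "noncrossing (odd_matching ts)"
proof (rule noncrossing_if_rainbows[where X = "K + M - 1" and blk = "\<lambda>v. (v - K + M) div (2 * M)"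
      and tot = "\<lambda>a. 2 * K + 4 * a * M - 1"])
  show "mono (\<lambda>v. (v - K + M) div (2 * M))" by (intro monoI div_le_mono diff_le_mono add_right_mono)
  fix P assume "P \<in> odd_matching ts"
  then obtain i where i: "Suc (2 * i) < N" "P = {ts ! Suc (2 * i), ts ! (Suc (Suc (2 * i)) mod N)}"
    by (auto simp: odd_matching_def length_ts)
  show "(\<exists>a. P = {a, Suc a}) \<or> P = {0, K + M - 1} \<or> (\<exists>p q. P = {p, q} \<and> K + M - 1 \<le> p \<and> K + M - 1 \<le> q \<and>
      (p - K + M) div (2 * M) = (q - K + M) div (2 * M) \<and>
      p + q = 2 * K + 4 * ((p - K + M) div (2 * M)) * M - 1)"
  proof (cases "2 * i < K")
    case True
    then have K: "Suc (2 * i) < K" using even_K by presburger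
    have N: "K < N" using M_pos by (simp add: N_def)
    have "ts ! Suc (Suc (2 * i)) = Suc (Suc (2 * i))"
    proof (cases "Suc (Suc (2 * i)) < K")
      case False
      then have "Suc (Suc (2 * i)) = K" using K by simp
      then show ?thesis using ts_nth_add[of 0] M_pos crossing_0 by simp
    qed (rule ts_nth_less)
    then show ?thesis using i K N ts_nth_less by auto
  next
    case False
    define j where "j = Suc (2 * i) - K"
    have j: "Suc (2 * i) = K + j" "odd j" "j < M * M"
      using False i even_K by (auto simp: j_def N_def)
    define y t where "y = j div M" and "t = j mod M"
    have jy: "j = y * M + t" by (simp add: y_def t_def)
    have t: "t < M" "odd t" using M_pos even_M j(2) by (auto simp: t_def even_M dvd_mod_iff)
    have y: "y < M" using j(3) by (simp add: y_def row_less)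
    consider "Suc t < M" | "Suc t = M" "Suc y = M" | "Suc t = M" "Suc y < M" using t y by linarith
    then show ?thesis
    proof cases
      case 1
      have "Suc j < M * M"
      proof -
        have "Suc j < Suc y * M" using 1 by (simp add: jy)
        also have "\<dots> \<le> M * M" using y by (intro mult_right_mono) auto
        finally show ?thesis .
      qed
      then have N: "K + Suc j < N" by (simp add: N_def)
      obtain x where x: "Suc x < M" "odd x"
        "{crossing (y * M + t), crossing (y * M + Suc t)} = {K + column_pos x y, K + column_pos (Suc x) y}"
        using row_step[OF y 1] t by metis
      have P: "P = {K + column_pos x y, K + column_pos (Suc x) y}"
        using i(2) x(3) ts_nth_add[of j] ts_nth_add[of "Suc j"] j \<open>Suc j < M * M\<close> N unfolding jy by simp
      obtain a where a: "x = 2 * a + 1" using x(2) by (elim oddE)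
      note c = column_pair[OF y x(1)]
      have "M \<le> x * M" using a by simp
      then have "M \<le> column_pos x y" "M \<le> column_pos (Suc x) y" using c by linarith+
      moreover have "(column_pos x y + M) div (2 * M) = Suc a" "(column_pos (Suc x) y + M) div (2 * M) = Suc a"
        using c(2-) M_pos unfolding a by (auto intro!: div_nat_eqI simp: algebra_simps)
      moreover have "column_pos x y + column_pos (Suc x) y + 1 = 4 * Suc a * M"
        using c(1) by (simp add: a algebra_simps)
      ultimately show ?thesis
        by (intro disjI2 exI[of _ "K + column_pos x y"] exI[of _ "K + column_pos (Suc x) y"] conjI P) auto
    next
      case 2
      \<comment> \<open>The closing arc: the last row has odd index, so it runs leftwards and ends
        at the last crossing of column 0.\<close>
      then have "j = M * M - 1" unfolding jy by (metis add_diff_cancel_left' add_Suc_right mult_Suc add.commute plus_1_eq_Suc)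
      then have "Suc (K + j) = N" using M_pos by (simp add: N_def)
      moreover have "ts ! 0 = 0" using ts_nth_less[of 0] ts_nth_add[of 0] crossing_0 M_pos by (cases "K = 0") auto
      moreover have "odd y" using 2 even_M by presburger
      then have "crossing j = K + M - 1"
        using 2 crossing_eq[OF t(1), of y] unfolding jy by (auto simp: snake_def column_pos_def)
      ultimately show ?thesis using i(2) j ts_nth_add[of j] by auto
    next
      case 3
      have j': "Suc j = Suc y * M + 0" using 3 jy by simp
      also have "Suc y * M + 0 < M * M"
        unfolding add_0_right using 3 M_pos by (intro mult_strict_right_mono) simp_all
      finally have sj: "Suc j < M * M" .
      then have N: "K + Suc j < N" by (simp add: N_def)
      have P: "P = {crossing (y * M + t), crossing (Suc y * M + 0)}"
        using i(2) ts_nth_add[of j] ts_nth_add[of "Suc j"] j sj N unfolding j'[symmetric] jy[symmetric] by simp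
      show ?thesis
      proof (cases "even y")
        case True
        have "crossing (y * M + t) = Suc (crossing (Suc y * M + 0))"
          using True 3 even_M M_pos unfolding crossing_eq[OF t(1)] crossing_eq[OF M_pos]
          by (auto simp: snake_def column_pos_def)
        then show ?thesis unfolding P by (metis insert_commute)
      next
        case False
        have "crossing (Suc y * M + 0) = Suc (crossing (y * M + t))"
          using False 3 unfolding crossing_eq[OF t(1)] crossing_eq[OF M_pos]
          by (auto simp: snake_def column_pos_def)
        then show ?thesis unfolding P by metis
      qed
    qed
  qed
qed

lemma cycle_notation_ts: "cycle_notation N (cycle_of_list ts) ts"
  using distinct_ts set_ts by (simp add: cycle_notation_def)

lemma cyclic_meandric_ts: "cyclic_meandric N (cycle_of_list ts)"
proof -
  have "N > 0" "even N" using M_pos even_M even_K by (simp_all add: N_def)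
  moreover have "cyclic_permutation N (cycle_of_list ts)"
    using cycle_notation_ts cyclic_permutation_iff_cycle_notation[OF \<open>N > 0\<close>] by blast
  ultimately show ?thesis
    unfolding cyclic_meandric_def using cycle_notation_ts noncrossing_even noncrossing_odd by blast
qed

text \<open>The set takes the crossing of each row \<open>y < m\<close> with column
  \<open>es ! y\<close>. The line meets these by increasing column and the curve by increasing row,
  whatever the directions of the strands. \<open>q\<close> enumerates the set along the line;
  \<open>f y\<close> is the time, counted from the start of the grid, at which the curve passes the
  crossing chosen in row \<open>y\<close>.\<close>

lemma ex_first_return:
  assumes es: "distinct es" "set es = {..<m}" and m: "m \<le> M" and r: "r \<le> K"
  shows "\<exists>S \<subseteq> {..<N}. card S = r + m \<and> first_return_list ts S = [0..<r] @ map (\<lambda>x. r + x) es"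
proof -
  have len: "length es = m" using distinct_card[OF es(1)] es(2) by simp
  have es_less: "es ! y < m" if "y < m" for y using that len es(2) nth_mem[of y es] by simp
  have "\<exists>k. k < m \<and> es ! k = x" if "x < m" for x
    using that len in_set_conv_nth[of x es] unfolding es(2) by auto
  then obtain pos where pos: "\<And>x. x < m \<Longrightarrow> pos x < m \<and> es ! pos x = x" by metis
  have pos_nth: "pos (es ! y) = y" if "y < m" for y
    using pos[OF es_less[OF that]] nth_eq_iff_index_eq[OF es(1), of "pos (es ! y)" y] len that by simp
  define q where "q i = (if i < r then i else K + column_pos (i - r) (pos (i - r)))" for i
  define f where "f y = y * M + snake y (es ! y)" for y
  have mono_q: "strict_mono_on {..<r + m} q"
  proof (rule strict_mono_onI)
    fix i j assume ij: "i \<in> {..<r + m}" "j \<in> {..<r + m}" "i < j"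
    show "q i < q j"
    proof (cases "i < r")
      case True
      then show ?thesis using ij r by (auto simp: q_def)
    next
      case False
      let ?x = "i - r" and ?x' = "j - r"
      have "?x < m" using ij False by auto
      then have "pos ?x < M" using pos[of ?x] m by simp
      then have "column_pos ?x (pos ?x) < Suc ?x * M" by (rule column_pos_less)
      also have "\<dots> \<le> ?x' * M" using ij False by (intro mult_right_mono) auto
      also have "\<dots> \<le> column_pos ?x' (pos ?x')" by (simp add: column_pos_def)
      finally show ?thesis using False ij by (simp add: q_def)
    qed
  qed
  have f_less: "f y < Suc y * M" if "y < m" for y
    using snake_less[of "es ! y" y] es_less[OF that] m by (simp add: f_def)
  have f_bound: "f y < M * M" if "y < m" for y
  proof -
    have "Suc y * M \<le> M * M" using that m by (intro mult_right_mono) auto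
    then show ?thesis using f_less[OF that] by linarith
  qed
  have mono_f: "strict_mono_on {..<m} f"
  proof (rule strict_mono_onI)
    fix i j assume ij: "i \<in> {..<m}" "j \<in> {..<m}" "i < j"
    have "f i < Suc i * M" using f_less ij by simp
    also have "\<dots> \<le> j * M" using ij by (intro mult_right_mono) auto
    also have "\<dots> \<le> f j" by (simp add: f_def)
    finally show "f i < f j" .
  qed
  have crossing_f: "crossing (f y) = q (r + es ! y)" if "y < m" for y
  proof -
    have "es ! y < M" using es_less[OF that] m by simp
    then show ?thesis using snake_less[of "es ! y" y] snake_snake[of "es ! y" y] pos_nth[OF that]
      by (simp add: f_def q_def crossing_eq)
  qed
  define S where "S = q ` {..<r + m}"
  have "q ` {..<r} = id ` {..<r}" by (intro image_cong) (simp_all add: q_def)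
  then have q1: "q ` {..<r} = {..<r}" by simp
  have q2: "crossing ` f ` {..<m} = q ` (\<lambda>y. r + es ! y) ` {..<m}"
    unfolding image_image by (intro image_cong) (simp_all add: crossing_f)
  have "{..<r + m} = {..<r} \<union> (\<lambda>y. r + es ! y) ` {..<m}"
  proof (intro equalityI subsetI)
    fix i assume i: "i \<in> {..<r + m}"
    show "i \<in> {..<r} \<union> (\<lambda>y. r + es ! y) ` {..<m}"
    proof (cases "i < r")
      case False
      then have "i = r + es ! pos (i - r)" "pos (i - r) < m" using i pos[of "i - r"] by auto
      then show ?thesis by blast
    qed simp
  qed (use es_less in auto)
  then have S: "S = {..<r} \<union> crossing ` f ` {..<m}"
    unfolding S_def q2 by (simp only: image_Un q1)
  have "filter (\<lambda>x. x \<in> S) ts = [0..<r] @ map crossing (map f [0..<m])"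
  proof -
    have cf: "K \<le> v" if "v \<in> crossing ` f ` {..<m}" for v
      using that crossing_bounds f_bound by auto
    have "filter (\<lambda>x. x \<in> S) [0..<K] = filter (\<lambda>x. x \<in> (\<lambda>i. i) ` {..<r}) [0..<K]"
    proof (intro filter_cong refl)
      fix v assume "v \<in> set [0..<K]"
      then have "\<not> K \<le> v" by simp
      then have "v \<notin> crossing ` f ` {..<m}" using cf[of v] by blast
      then show "v \<in> S \<longleftrightarrow> v \<in> (\<lambda>i. i) ` {..<r}" unfolding S by simp
    qed
    also have "\<dots> = [0..<r]" using r by (subst filter_upt_image) (auto simp: strict_mono_on_def)
    finally have 1: "filter (\<lambda>x. x \<in> S) [0..<K] = [0..<r]" .
    have "filter (\<lambda>x. x \<in> S) (map crossing [0..<M * M]) =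
        map crossing (filter (\<lambda>j. crossing j \<in> S) [0..<M * M])"
      by (simp add: filter_map comp_def)
    also have "filter (\<lambda>j. crossing j \<in> S) [0..<M * M] = filter (\<lambda>j. j \<in> f ` {..<m}) [0..<M * M]"
    proof (rule filter_cong[OF refl])
      fix j assume "j \<in> set [0..<M * M]"
      then have j: "j < M * M" by simp
      then have "crossing j \<in> S \<longleftrightarrow> crossing j \<in> crossing ` f ` {..<m}"
        using crossing_bounds[OF j] r by (auto simp: S)
      also have "\<dots> \<longleftrightarrow> j \<in> f ` {..<m}"
        using crossing_inject[OF j] f_bound by blast
      finally show "crossing j \<in> S \<longleftrightarrow> j \<in> f ` {..<m}" .
    qed
    also have "\<dots> = map f [0..<m]" by (rule filter_upt_image[OF mono_f f_bound])
    finally show ?thesis using 1 by (simp add: ts_def)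
  qed
  also have "map crossing (map f [0..<m]) = map q (map (\<lambda>x. r + x) es)"
    using crossing_f len by (intro nth_equalityI) auto
  finally have "first_return_list ts S =
      map (relabel S) [0..<r] @ map (relabel S) (map q (map (\<lambda>x. r + x) es))"
    by (simp add: first_return_list_def)
  moreover have rel: "relabel S (q i) = i" if "i < r + m" for i
    unfolding S_def by (rule relabel_image[OF mono_q that])
  have "map (relabel S) [0..<r] = map (\<lambda>i. i) [0..<r]"
  proof (intro map_cong refl)
    fix i assume "i \<in> set [0..<r]"
    then show "relabel S i = i" using rel[of i] by (simp add: q_def)
  qed
  moreover have "map (relabel S) (map q (map (\<lambda>x. r + x) es)) = map (\<lambda>x. r + x) es"
    using rel es(2) by auto
  moreover have "card S = r + m"
    unfolding S_def using card_image[OF strict_mono_on_imp_inj_on[OF mono_q]] by simp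
  moreover have "S \<subseteq> {..<N}"
    unfolding S using crossing_bounds f_bound r by (auto simp: N_def)
  ultimately show ?thesis by (intro exI[of _ S]) simp
qed

end

theorem ex_small_meander:
  fixes es :: "nat list" and m r :: nat
  assumes es: "distinct es" "set es = {..<m}" and m: "m > 0"
  defines "\<sigma> \<equiv> cycle_of_list ([0..<r] @ map (\<lambda>x. r + x) es)"
  shows "\<exists>N \<tau> S. N \<le> r + 1 + (m + 1)\<^sup>2 \<and> even N \<and> cyclic_meandric N \<tau> \<and> S \<subseteq> {..<N} \<and> card S = r + m \<and>
    is_first_return N \<tau> S \<sigma>"
proof -
  \<comment> \<open>Rounding up to even numbers meets the parity demands of the grid and causes the
    two \<open>+ 1\<close> in the bound.\<close>
  define M K where "M = (if even m then m else m + 1)" and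
    "K = (if even r then r else r + 1)"
  interpret grid_meander M K
    by standard (use m in \<open>auto simp: M_def K_def\<close>)
  have "m \<le> M" "r \<le> K" by (auto simp: M_def K_def)
  obtain S where S: "S \<subseteq> {..<N}" "card S = r + m"
      "first_return_list ts S = [0..<r] @ map (\<lambda>x. r + x) es"
    using ex_first_return[OF es \<open>m \<le> M\<close> \<open>r \<le> K\<close>] by blast
  have "cycle_notation (card S) \<sigma> (first_return_list ts S)"
  proof -
    have "{..<r + m} = {..<r} \<union> (\<lambda>x. r + x) ` {..<m}"
    proof (intro equalityI subsetI)
      fix x assume "x \<in> {..<r + m}"
      then show "x \<in> {..<r} \<union> (\<lambda>x. r + x) ` {..<m}"
        by (cases "x < r") (auto intro!: image_eqI[of _ _ "x - r"])
    qed auto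
    then show ?thesis
      unfolding cycle_notation_def S(2,3) \<sigma>_def using es by (auto simp: distinct_map)
  qed
  then have "is_first_return N (cycle_of_list ts) S \<sigma>"
    using cycle_notation_ts by (auto simp: is_first_return_def)
  moreover have "N \<le> r + 1 + (m + 1)\<^sup>2"
  proof -
    have "M * M \<le> (m + 1) * (m + 1)" by (auto simp: M_def)
    moreover have "K \<le> r + 1" by (simp add: K_def)
    ultimately show ?thesis unfolding N_def power2_eq_square by linarith
  qed
  moreover have "even N" using even_K even_M by (simp add: N_def)
  ultimately show ?thesis using S cyclic_meandric_ts by blast
qed

section \<open>Bounds for the meander number\<close>

lemma changes_Cons_filter: "changes (b # map P (filter Q xs)) \<le> changes (b # map P xs)"
proof (induction xs arbitrary: b)
  case (Cons x xs)
  have "changes (b # map P xs) \<le> changes (b # P x # map P xs)"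
    by (cases xs) auto
  then show ?case using Cons.IH[of "P x"] Cons.IH[of b] by auto
qed simp

lemma changes_filter: "changes (map P (filter Q xs)) \<le> changes (map P xs)"
proof (induction xs)
  case (Cons x xs)
  have "changes (map P xs) \<le> changes (P x # map P xs)" by (cases xs) auto
  then show ?case using changes_Cons_filter[of "P x" P Q xs] Cons.IH by auto
qed simp

lemma changes_append: "changes xs + changes ys \<le> changes (xs @ ys)"
  "changes (xs @ ys) \<le> changes xs + changes ys + 1"
proof -
  have "changes xs + changes ys \<le> changes (xs @ ys) \<and> changes (xs @ ys) \<le> changes xs + changes ys + 1"
  proof (induction xs rule: changes.induct)
    case ("2_2" v)
    then show ?case by (cases ys) auto
  qed auto
  then show "changes xs + changes ys \<le> changes (xs @ ys)"
    "changes (xs @ ys) \<le> changes xs + changes ys + 1" by auto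
qed

lemma changes_rotate: "changes xs \<le> changes (rotate k xs) + 1"
proof -
  let ?a = "take (k mod length xs) xs" and ?b = "drop (k mod length xs) xs"
  have "changes xs \<le> changes ?a + changes ?b + 1" using changes_append(2)[of ?a ?b] by simp
  moreover have "changes ?b + changes ?a \<le> changes (?b @ ?a)" by (rule changes_append)
  ultimately show ?thesis by (simp add: rotate_drop_take)
qed

lemma filter_rotate: "\<exists>l. filter P (rotate k xs) = rotate l (filter P xs)"
proof -
  let ?a = "take (k mod length xs) xs" and ?b = "drop (k mod length xs) xs"
  have "filter P (rotate k xs) = filter P ?b @ filter P ?a" by (simp add: rotate_drop_take)
  also have "\<dots> = rotate (length (filter P ?a)) (filter P ?a @ filter P ?b)"
    by (simp add: rotate_append)
  also have "filter P ?a @ filter P ?b = filter P xs" by (metis append_take_drop_id filter_append)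
  finally show ?thesis by blast
qed

lemma relabel_sorted:
  assumes "S \<subseteq> {..<N}" "relabel S ` S = {..<card S}"
  shows "map (relabel S) (filter (\<lambda>x. x \<in> S) [0..<N]) = [0..<card S]"
proof -
  let ?xs = "filter (\<lambda>x. x \<in> S) [0..<N]"
  have fS: "finite S" using assms finite_subset by blast
  have set: "set ?xs = S" using assms by auto
  then have len: "length ?xs = card S" by (metis distinct_card distinct_filter distinct_upt)
  have s: "set (map (relabel S) ?xs) = {..<card S}" using assms set by simp
  have "relabel S x \<le> relabel S y" if "x \<le> y" for x y
    unfolding relabel_def using fS that by (intro card_mono) auto
  moreover have "sorted ?xs" by (rule sorted_wrt_filter) simp
  ultimately have "sorted (map (relabel S) ?xs)" by (simp add: sorted_iff_nth_mono)
  moreover have "distinct (map (relabel S) ?xs)"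
    using s len by (intro card_distinct) (simp only: length_map card_lessThan)
  ultimately show ?thesis using s by (intro sorted_distinct_set_unique) auto
qed

lemma changes_map_transfer:
  assumes "map \<phi> (filter Q xs) = ys" "inj_on \<phi> W" "\<And>x. x \<in> set xs \<Longrightarrow> Q x \<Longrightarrow> x \<in> W"
  shows "changes (map (\<lambda>i. i \<in> \<phi> ` (W \<inter> Z)) ys) \<le> changes (map (\<lambda>x. x \<in> Z) xs)"
proof -
  have "map (\<lambda>i. i \<in> \<phi> ` (W \<inter> Z)) ys = map (\<lambda>x. x \<in> Z) (filter Q xs)"
    unfolding assms(1)[symmetric] using assms(2,3)
    by (auto simp: inj_on_image_mem_iff)
  then show ?thesis using changes_filter by simp
qed

text \<open>The separator \<open>Z\<close>, restricted to the last \<open>m\<close> chosen points,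
  becomes a balanced set of labels. Deleting the other letters creates no changes, so expansion
  forces many changes of \<open>Z\<close> along the line or along the curve.\<close>

theorem expanding_meander_bound:
  assumes es: "distinct es" "set es = {..<m}" "expanding m es" and "m \<ge> 10" and "s > 0"
    and \<tau>: "cyclic_meandric N \<tau>" and S: "S \<subseteq> {..<N}" "card S = r + m"
    and fr: "is_first_return N \<tau> S (cycle_of_list ([0..<r] @ map (\<lambda>x. r + x) es))"
  shows "s * (m div 300) \<le> 16 * N + s * (4 * s + 9)"
proof -
  define fs where "fs = [0..<r] @ map (\<lambda>x. r + x) es"
  obtain ts where ts: "cycle_notation N \<tau> ts" "noncrossing (even_matching ts)"
    "noncrossing (odd_matching ts)" and N: "even N" "N > 0"
    using \<tau> by (auto simp: cyclic_meandric_def)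
  interpret meandric_list N ts
  proof
    show "distinct ts" "set ts = {..<N}" using ts(1) by (simp_all add: cycle_notation_def)
  qed (fact ts N)+
  \<comment> \<open>The list witnessing the first return need not be the one witnessing the
    noncrossing matchings; both write the same cycle, so they differ by a rotation.\<close>
  obtain ts' where ts': "cycle_notation N \<tau> ts'"
    "cycle_notation (card S) (cycle_of_list fs) (first_return_list ts' S)"
    using fr by (auto simp: is_first_return_def fs_def)
  let ?frl = "first_return_list ts' S"
  have rel: "relabel S ` S = {..<card S}"
  proof -
    have "set ?frl = relabel S ` S"
      using ts'(1) S(1) by (auto simp: first_return_list_def cycle_notation_def)
    then show ?thesis using ts'(2) by (simp add: cycle_notation_def)
  qed
  have "set fs = {..<card S}"
  proof -
    have "set fs = {..<r} \<union> (\<lambda>x. r + x) ` {0..<m}" using es by (simp add: fs_def atLeast0LessThan)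
    also have "(\<lambda>x. r + x) ` {0..<m} = {r..<r + m}"
      using image_add_atLeastLessThan[of r 0 m] by (simp add: add.commute)
    finally show ?thesis using S by auto
  qed
  moreover have "distinct fs" by (auto simp: fs_def distinct_map es(1,2))
  ultimately have "cycle_notation (card S) (cycle_of_list fs) fs" by (simp add: cycle_notation_def)
  then obtain k\<^sub>1 where k1: "?frl = rotate k\<^sub>1 fs" using cycle_notation_unique[OF _ ts'(2)] by blast
  obtain k\<^sub>2 where "ts = rotate k\<^sub>2 ts'" using cycle_notation_unique[OF ts'(1) ts(1)] by blast
  then obtain k\<^sub>3 where "first_return_list ts S = rotate k\<^sub>3 ?frl"
    using first_return_list_rotate[of k\<^sub>2 ts' S] by blast
  then have frl: "first_return_list ts S = rotate (k\<^sub>3 + k\<^sub>1) fs" using k1 by (simp add: rotate_rotate)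

  define Q where "Q = (\<lambda>x. x \<in> S \<and> r \<le> relabel S x)"
  define \<phi> where "\<phi> = (\<lambda>x. relabel S x - r)"
  define W where "W = {x \<in> {..<N}. Q x}"
  have high: "map \<phi> (filter Q xs) = map (\<lambda>i. i - r) (filter (\<lambda>i. r \<le> i) (map (relabel S) (filter (\<lambda>x. x \<in> S) xs)))"
    for xs by (simp add: \<phi>_def Q_def filter_map comp_def conj_commute)
  have up: "map \<phi> (filter Q [0..<N]) = [0..<m]"
  proof -
    have "[0..<r + m] = [0..<r] @ [r..<r + m]" by (rule upt_add_eq_append) simp
    then have "filter (\<lambda>i. r \<le> i) [0..<r + m] = [r..<r + m]" by simp
    then show ?thesis
      unfolding high relabel_sorted[OF S(1) rel] S(2) by (simp only:) (rule nth_equalityI, simp_all)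
  qed
  obtain k where k: "map \<phi> (filter Q ts) = rotate k es"
  proof -
    have fs: "filter (\<lambda>i. r \<le> i) fs = map (\<lambda>x. r + x) es" by (simp add: fs_def filter_map comp_def)
    obtain l where "filter (\<lambda>i. r \<le> i) (rotate (k\<^sub>3 + k\<^sub>1) fs) = rotate l (map (\<lambda>x. r + x) es)"
      using filter_rotate[of "\<lambda>i. r \<le> i" "k\<^sub>3 + k\<^sub>1" fs] unfolding fs by blast
    then have "map \<phi> (filter Q ts) = rotate l es"
      unfolding high using frl by (simp add: first_return_list_def rotate_map comp_def)
    then show ?thesis using that by blast
  qed
  have WQ: "W = set (filter Q [0..<N])" by (auto simp: W_def)
  have inj: "inj_on \<phi> W"
    using up unfolding WQ by (metis distinct_map distinct_upt)
  have "\<phi> ` W = set [0..<m]" unfolding WQ up[symmetric] by simp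
  then have img: "\<phi> ` W = {..<m}" by (simp add: atLeast0LessThan)
  then have cW: "card W = m" using card_image[OF inj] by simp
  obtain Z where Z: "card W \<le> 10 * card (W \<inter> Z)" "10 * card (W \<inter> Z) \<le> 9 * card W"
    "s * changes (map (\<lambda>x. x \<in> Z) [0..<N]) \<le> 16 * N + s * (4 * s + 9)"
    "s * changes (map (\<lambda>x. x \<in> Z) ts) \<le> 16 * N + s * (4 * s + 9)"
    using separator[of W s] \<open>m \<ge> 10\<close> \<open>s > 0\<close> cW by (auto simp: W_def)
  define A where "A = \<phi> ` (W \<inter> Z)"
  have "card A = card (W \<inter> Z)"
    unfolding A_def using inj by (intro card_image) (auto intro: inj_on_subset)
  then have "balanced m A"
    using Z(1,2) cW img by (auto simp: balanced_def A_def)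
  then consider "m div 300 < changes (map (\<lambda>x. x \<in> A) [0..<m])" | "m div 300 < changes (map (\<lambda>x. x \<in> A) es)"
    using es(3) by (auto simp: expanding_def)
  then show ?thesis
  proof cases
    case 1
    also have "changes (map (\<lambda>x. x \<in> A) [0..<m]) \<le> changes (map (\<lambda>x. x \<in> Z) [0..<N])"
      unfolding A_def by (rule changes_map_transfer[OF up inj]) (simp add: W_def)
    finally have "s * (m div 300) \<le> s * changes (map (\<lambda>x. x \<in> Z) [0..<N])" by simp
    then show ?thesis using Z(3) by linarith
  next
    case 2
    \<comment> \<open>The change lost by starting \<open>es\<close> elsewhere is paid for by the
      strict inequality in \<open>expanding\<close>.\<close>
    also have "changes (map (\<lambda>x. x \<in> A) es) \<le> changes (map (\<lambda>x. x \<in> A) (rotate k es)) + 1"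
      unfolding rotate_map[symmetric] by (rule changes_rotate)
    also have "changes (map (\<lambda>x. x \<in> A) (rotate k es)) \<le> changes (map (\<lambda>x. x \<in> Z) ts)"
      unfolding A_def using set_ts by (intro changes_map_transfer[OF k inj]) (auto simp: W_def)
    finally have "s * (m div 300) \<le> s * changes (map (\<lambda>x. x \<in> Z) ts)" by simp
    then show ?thesis using Z(4) by linarith
  qed
qed

text \<open>With \<open>s\<close> about \<open>k / 8\<close> the error term
  \<open>s * (4 * s + 9)\<close> leaves at least \<open>s * s\<close> of \<open>s * k\<close>,
  whence \<open>s * s \<le> 16 * N\<close>. As \<open>m \<le> 9600 * s\<close>, the constant is
  \<open>16 * 9600 ^ 2\<close> rounded up.\<close>

lemma expanding_meander_size:
  assumes es: "distinct es" "set es = {..<m}" "expanding m es" and m: "m \<ge> 30000"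
    and \<tau>: "cyclic_meandric N \<tau>" and S: "S \<subseteq> {..<N}" "card S = r + m"
    and fr: "is_first_return N \<tau> S (cycle_of_list ([0..<r] @ map (\<lambda>x. r + x) es))"
  shows "m\<^sup>2 \<le> 1500000000 * N"
proof -
  define k s where "k = m div 300" and "s = k div 8"
  have k: "k \<ge> 100" using m by (simp add: k_def)
  then have s: "s \<ge> 12" "k \<le> 16 * s" "8 * s \<le> k" by (auto simp: s_def)
  have "s * k \<le> 16 * N + s * (4 * s + 9)"
    unfolding k_def using m s by (intro expanding_meander_bound[OF es _ _ \<tau> S fr]) auto
  moreover have "s * (4 * s + 9 + s) \<le> s * k" using s by (intro mult_left_mono) auto
  ultimately have "s * s \<le> 16 * N" by (simp add: distrib_left)
  moreover have "m \<le> 600 * k" using k unfolding k_def by linarith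
  then have "m \<le> 9600 * s" using s by simp
  then have "m\<^sup>2 \<le> (9600 * s)\<^sup>2" by (rule power_mono) simp
  ultimately show ?thesis by (simp add: power2_eq_square)
qed
text \<open>The guard makes the choice satisfiable for every \<open>m\<close>, so that a cyclic
  permutation is obtained for small \<open>n\<close> as well.\<close>

definition expander_list :: "nat \<Rightarrow> nat list" where
  "expander_list m = (SOME es. distinct es \<and> set es = {..<m} \<and> (m \<ge> 200 \<longrightarrow> expanding m es))"

lemma expander_list:
  "distinct (expander_list m) \<and> set (expander_list m) = {..<m} \<and> (m \<ge> 200 \<longrightarrow> expanding m (expander_list m))"
proof -
  have "\<exists>es. distinct es \<and> set es = {..<m} \<and> (m \<ge> 200 \<longrightarrow> expanding m es)"
  proof (cases "m \<ge> 200")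
    case False
    then show ?thesis by (intro exI[of _ "[0..<m]"]) (simp add: atLeast0LessThan)
  qed (use ex_expanding in blast)
  then show ?thesis unfolding expander_list_def by (rule someI_ex)
qed

definition expander_cycle :: "nat \<Rightarrow> nat \<Rightarrow> nat \<Rightarrow> nat" where
  "expander_cycle r m = cycle_of_list ([0..<r] @ map (\<lambda>x. r + x) (expander_list m))"

lemma cyclic_permutation_expander_cycle:
  assumes "r + m > 0"
  shows "cyclic_permutation (r + m) (expander_cycle r m)"
proof -
  let ?ts = "[0..<r] @ map (\<lambda>x. r + x) (expander_list m)"
  have "set ?ts = {0..<r} \<union> {r..<r + m}"
    using expander_list[of m] image_add_atLeastLessThan[of r 0 m]
    by (simp add: atLeast0LessThan add.commute)
  then have "set ?ts = {..<r + m}" by auto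
  moreover have "distinct ?ts"
    using expander_list[of m] by (simp add: distinct_map) (simp add: disjoint_iff image_iff)
  ultimately have "cycle_notation (r + m) (expander_cycle r m) ?ts"
    by (simp only: cycle_notation_def expander_cycle_def simp_thms)
  then show ?thesis using cyclic_permutation_iff_cycle_notation[OF assms] by blast
qed

lemma meander_number_expander_cycle:
  assumes m: "m \<ge> 30000"
  shows "meander_number (r + m) (expander_cycle r m) \<le> r + 1 + (m + 1)\<^sup>2"
    and "m\<^sup>2 \<le> 1500000000 * meander_number (r + m) (expander_cycle r m)"
proof -
  let ?P = "\<lambda>N. even N \<and> (\<exists>\<tau> S. cyclic_meandric N \<tau> \<and> S \<subseteq> {..<N} \<and> card S = r + m \<and>
    is_first_return N \<tau> S (expander_cycle r m))"
  have es: "distinct (expander_list m)" "set (expander_list m) = {..<m}" "expanding m (expander_list m)"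
    using expander_list[of m] m by auto
  obtain N where N: "N \<le> r + 1 + (m + 1)\<^sup>2" "?P N"
    using ex_small_meander[OF es(1,2), of r] m unfolding expander_cycle_def by auto
  have "meander_number (r + m) (expander_cycle r m) \<le> N"
    unfolding meander_number_def using N(2) by (rule Least_le)
  then show "meander_number (r + m) (expander_cycle r m) \<le> r + 1 + (m + 1)\<^sup>2" using N(1) by simp
  have "?P (meander_number (r + m) (expander_cycle r m))"
    unfolding meander_number_def using N(2) by (rule LeastI)
  then show "m\<^sup>2 \<le> 1500000000 * meander_number (r + m) (expander_cycle r m)"
    using expanding_meander_size[OF es m] unfolding expander_cycle_def by blast
qed

text \<open>Since n L is at most \<open>4 * m\<^sup>2\<close>, it is at most 6 * 10^9 times
  \<open>M\<close>. The threshold on \<open>L\<close> bounds \<open>n\<close> by n L / (2 * 10^10),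
  and the difference of the reciprocals of 6 * 10^9 and 2 * 10^10 still exceeds that of 12 *
  10^9.\<close>

lemma meander_number_bounds:
  fixes L :: int and n m :: nat
  assumes n: "n \<ge> 1" and L: "20000000000 \<le> L" "L \<le> int n"
    and m: "m = nat \<lfloor>sqrt (real n * real_of_int L)\<rfloor>"
  defines "M \<equiv> meander_number n (expander_cycle (n - m) m)"
  shows "1 / 12000000000 * real n * real_of_int L \<le> real M - real n"
    and "real M - real n \<le> 5 * real n * real_of_int L"
proof -
  define x where "x = real n * real_of_int L"
  have x0: "x \<ge> 0" using L by (simp add: x_def)
  have "real m = of_int \<lfloor>sqrt x\<rfloor>" using x0 unfolding m x_def by simp
  then have ms: "real m \<le> sqrt x" "sqrt x < real m + 1" by linarith+
  have "x \<le> real n * real n" using L by (auto simp: x_def intro!: mult_left_mono)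
  then have "sqrt x \<le> real n" by (intro real_le_lsqrt) (auto simp: power2_eq_square)
  then have mn: "m \<le> n" using ms(1) by linarith
  have "1 * 20000000000 \<le> x" unfolding x_def using n L by (intro mult_mono) auto
  then have "sqrt x \<ge> 100000" by (intro real_le_rsqrt) simp
  then have m_big: "m \<ge> 30000" using ms(2) by linarith
  have rm: "(n - m) + m = n" using mn by simp
  have b: "M \<le> (n - m) + 1 + (m + 1)\<^sup>2" "m\<^sup>2 \<le> 1500000000 * M"
    using meander_number_expander_cycle[OF m_big, of "n - m"] unfolding M_def rm by auto
  have "real m * real m \<le> sqrt x * sqrt x" using ms x0 by (intro mult_mono) auto
  then have mx: "real m * real m \<le> x" using x0 by simp
  have "sqrt x \<le> 2 * real m" using ms m_big by linarith
  then have "sqrt x * sqrt x \<le> (2 * real m) * (2 * real m)" using x0 by (intro mult_mono) auto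
  then have xm: "x \<le> 4 * (real m * real m)" using x0 by simp
  have "real M \<le> real ((n - m) + 1 + (m + 1)\<^sup>2)" using b(1) by (rule of_nat_mono)
  also have "\<dots> = real n - real m + 1 + (real m * real m + 2 * real m + 1)"
    using mn by (simp add: power2_eq_square of_nat_diff algebra_simps)
  finally have "real M - real n \<le> real m * real m + real m + 2" by simp
  moreover have "real m * 2 \<le> real m * real m" using m_big by (intro mult_left_mono) auto
  ultimately have "real M - real n \<le> 5 * (real m * real m)" using m_big by linarith
  then have "real M - real n \<le> 5 * x" using mx by linarith
  then show "real M - real n \<le> 5 * real n * real_of_int L"
    unfolding x_def by (simp add: mult.assoc)
  have "real (m\<^sup>2) \<le> real (1500000000 * M)" using b(2) by (rule of_nat_mono)
  then have "real m * real m \<le> 1500000000 * real M" by (simp add: power2_eq_square)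
  then have 1: "x \<le> 6000000000 * real M" using xm by linarith
  have "real n * 20000000000 \<le> x" unfolding x_def using L by (intro mult_left_mono) auto
  then have "1 / 12000000000 * x \<le> real M - real n" using 1 x0 by (simp add: field_simps)
  then show "1 / 12000000000 * real n * real_of_int L \<le> real M - real n"
    unfolding x_def by (simp add: mult.assoc)
qed

theorem theoremB:
  fixes L :: "nat \<Rightarrow> int"
  assumes "\<And>n. n \<ge> 1 \<Longrightarrow> 1 \<le> L n \<and> L n \<le> int n"
    and "filterlim L at_top sequentially"
  shows "\<exists>\<sigma> :: nat \<Rightarrow> nat \<Rightarrow> nat.
    (\<forall>n\<ge>1. cyclic_permutation n (\<sigma> n)) \<and>
    (\<exists>c C :: real. c > 0 \<and> C > 0 \<and>
      (\<forall>\<^sub>F n in sequentially.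
        c * real n * real_of_int (L n) \<le> real (meander_number n (\<sigma> n)) - real n \<and>
        real (meander_number n (\<sigma> n)) - real n \<le> C * real n * real_of_int (L n)))"
proof -
  define m where "m n = nat \<lfloor>sqrt (real n * real_of_int (L n))\<rfloor>" for n
  define \<sigma> where "\<sigma> n = expander_cycle (n - m n) (m n)" for n
  have "cyclic_permutation n (\<sigma> n)" if n: "n \<ge> 1" for n
  proof -
    \<comment> \<open>The bound \<open>L n \<le> int n\<close> makes room for \<open>m n\<close>
      special points among \<open>n\<close>.\<close>
    have "real n * real_of_int (L n) \<le> real n * real n"
      using assms(1)[OF n] by (intro mult_left_mono) auto
    then have "sqrt (real n * real_of_int (L n)) \<le> real n"
      by (intro real_le_lsqrt) (auto simp: power2_eq_square)
    then have "m n \<le> n" unfolding m_def by linarith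
    then show ?thesis
      using cyclic_permutation_expander_cycle[of "n - m n" "m n"] n by (simp add: \<sigma>_def)
  qed
  moreover have "\<forall>\<^sub>F n in sequentially.
      1 / 12000000000 * real n * real_of_int (L n) \<le> real (meander_number n (\<sigma> n)) - real n \<and>
      real (meander_number n (\<sigma> n)) - real n \<le> 5 * real n * real_of_int (L n)"
  proof -
    have "\<forall>\<^sub>F n in sequentially. 20000000000 \<le> L n"
      using assms(2) by (simp add: filterlim_at_top)
    then show ?thesis
      using eventually_ge_at_top[of 1]
    proof eventually_elim
      case (elim n)
      then show ?case
        using meander_number_bounds[of n "L n" "m n"] assms(1)[of n] by (simp add: m_def \<sigma>_def)
    qed
  qed
  ultimately show ?thesis
    by (intro exI[of _ \<sigma>] conjI allI impI exI[of _ "1 / 12000000000"] exI[of _ 5]) auto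
qed

end
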